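(* Let $\psi=(\psi_1,\ldots,\psi_m)$ be a dictionary that is not a loop, i.e. $\psi(0)\neq\psi(1)$. Suppose that its core tensor $C=C_\psi\in(\mathbb{R}^m)^{\otimes 3}$ is symmetrically concise, has rank $r$ (over $\mathbb{R}$), and that the number $\delta$ of minimal decompositions of $C$ is finite. Given a generic matrix $X\in\mathbb{R}^{d\times m}$ with $m\le d$, there are at most $$\delta\cdot\frac{r!}{(r-m)!}$$ matrices $Y\in\mathbb{R}^{d\times m}$ that have the same third order signature tensor as $X$, i.e. that satisfy $[\![C;Y,Y,Y]\!]=[\![C;X,X,X]\!]$.
   Context: A dictionary is a tuple $\psi=(\psi_1,\ldots,\psi_m)$ of piecewise differentiable functions $\psi_i:[0,1]\to\mathbb{R}$, regarded as a path in $\mathbb{R}^m$. Its core tensor $C_\psi=(c_{ijk})\in\mathbb{R}^{m\times m\times m}$ is its third order signature, $$c_{ijk}=\int_0^1\left(\int_0^{t_3}\left(\int_0^{t_2}\mathrm{d}\psi_i(t_1)\right)\mathrm{d}\psi_j(t_2)\right)\mathrm{d}\psi_k(t_3).$$ For $X=(x_{ij})\in\mathbb{R}^{d\times m}$, the third order signature tensor of $X$ is that of the path $X\psi$ in $\mathbb{R}^d$; it equals $[\![C;X,X,X]\!]\in\mathbb{R}^{d\times d\times d}$, with entries $[\![C;X,X,X]\!]_{\alpha\beta\gamma}=\sum_{i,j,k=1}^m c_{ijk}\,x_{\alpha i}x_{\beta j}x_{\gamma k}$. A tensor $C\in(\mathbb{R}^m)^{\otimes 3}$ is symmetrically concise if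 there is no proper linear subspace $W\subsetneq\mathbb{R}^m$ with $C\in W^{\otimes 3}$. A rank one tensor is one of the form $v^{(1)}\otimes v^{(2)}\otimes v^{(3)}$ with non-zero $v^{(j)}\in\mathbb{R}^m$. The rank $r$ of $C$ is the minimal number of terms in an expression of $C$ as a sum of rank one tensors; an expression with $r$ terms is a minimal decomposition, and two decompositions are considered the same if they differ by re-ordering of the rank one terms. "Generic $X$" means $X$ outside some proper Zariski closed subset of $\mathbb{R}^{d\times m}$. *)

theory Defs
  imports "HOL-Analysis.Analysis" "HOL-Library.Multiset"
begin

text \<open>Only the values of \<open>\<psi>\<close> on the unit interval matter.\<close>

definition dictionary :: "(real \<Rightarrow> real ^ 'm) \<Rightarrow> bool" where
  "dictionary \<psi> \<longleftrightarrow> (\<forall>i. (\<lambda>t. \<psi> t $ i) piecewise_differentiable_on {0..1})"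

text \<open>
  Here \<open>d\<psi>\<^sub>i\<close> is \<open>\<psi>\<^sub>i'(t) dt\<close>. At the finitely many points where \<open>\<psi>\<^sub>i\<close> may fail to be
  differentiable (and at the end points) \<open>deriv\<close> has some unspecified value, which does not
  affect the integrals.
\<close>

definition iterated1 :: "(real \<Rightarrow> real ^ 'm) \<Rightarrow> 'm \<Rightarrow> real \<Rightarrow> real" where
  "iterated1 \<psi> i t = integral {0..t} (deriv (\<lambda>u. \<psi> u $ i))"

definition iterated2 :: "(real \<Rightarrow> real ^ 'm) \<Rightarrow> 'm \<Rightarrow> 'm \<Rightarrow> real \<Rightarrow> real" where
  "iterated2 \<psi> i j t = integral {0..t} (\<lambda>s. iterated1 \<psi> i s * deriv (\<lambda>u. \<psi> u $ j) s)"

definition core_tensor :: "(real \<Rightarrow> real ^ 'm) \<Rightarrow> real ^ 'm ^ 'm ^ 'm" where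
  "core_tensor \<psi> = (\<chi> i j k.
     integral {0..1} (\<lambda>s. iterated2 \<psi> i j s * deriv (\<lambda>u. \<psi> u $ k) s))"

text \<open>
  For a continuous path with a possibly unbounded derivative the iterated integrals need not
  exist, and \<open>integral\<close> would then silently be 0. This predicate says that all integrals in the
  definition of the core tensor exist. (On the first level existence is automatic for a
  dictionary.) It holds for instance whenever the derivatives are absolutely integrable, in
  particular for paths that are continuously differentiable up to the break points; see
  \<open>has_core_tensor_if_absolutely_integrable\<close> below.
\<close>

definition has_core_tensor :: "(real \<Rightarrow> real ^ 'm) \<Rightarrow> bool" where
  "has_core_tensor \<psi> \<longleftrightarrow>
     (\<forall>i j. (\<lambda>s. iterated1 \<psi> i s * deriv (\<lambda>u. \<psi> u $ j) s) integrable_on {0..1}) \<and>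
     (\<forall>i j k. (\<lambda>s. iterated2 \<psi> i j s * deriv (\<lambda>u. \<psi> u $ k) s) integrable_on {0..1})"

lemma has_core_tensor_if_absolutely_integrable:
  fixes \<psi> :: "real \<Rightarrow> real ^ 'm"
  assumes "\<And>i. deriv (\<lambda>t. \<psi> t $ i) absolutely_integrable_on {0..1}"
  shows "has_core_tensor \<psi>"
proof -
  have prod: "(\<lambda>s. f s * deriv (\<lambda>t. \<psi> t $ j) s) integrable_on {0..1}"
    if "continuous_on {0..1} f" for f j
  proof -
    have "(\<lambda>s. f s * deriv (\<lambda>t. \<psi> t $ j) s) absolutely_integrable_on {0..1}"
      by (intro absolutely_integrable_bounded_measurable_product_real assms
          compact_imp_bounded compact_continuous_image that continuous_imp_measurable_on_sets_lebesgue)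
        auto
    then show ?thesis
      by (rule set_lebesgue_integral_eq_integral(1))
  qed
  have "continuous_on {0..1} (iterated1 \<psi> i)" for i
    unfolding iterated1_def
    by (intro indefinite_integral_continuous_1 set_lebesgue_integral_eq_integral(1) assms)
  then have level2: "(\<lambda>s. iterated1 \<psi> i s * deriv (\<lambda>t. \<psi> t $ j) s) integrable_on {0..1}" for i j
    by (rule prod)
  then have "continuous_on {0..1} (iterated2 \<psi> i j)" for i j
    unfolding iterated2_def by (intro indefinite_integral_continuous_1)
  with level2 show ?thesis
    unfolding has_core_tensor_def by (auto intro: prod)
qed

definition tensor_act ::
  "real ^ 'm ^ 'm ^ 'm \<Rightarrow> real ^ 'm ^ 'd \<Rightarrow> real ^ 'm ^ 'd \<Rightarrow> real ^ 'm ^ 'd \<Rightarrow> real ^ 'd ^ 'd ^ 'd"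
  where
  "tensor_act C X Y Z = (\<chi> a b c.
     \<Sum>i\<in>UNIV. \<Sum>j\<in>UNIV. \<Sum>k\<in>UNIV. C $ i $ j $ k * X $ a $ i * Y $ b $ j * Z $ c $ k)"

definition outer3 :: "real ^ 'm \<Rightarrow> real ^ 'm \<Rightarrow> real ^ 'm \<Rightarrow> real ^ 'm ^ 'm ^ 'm" where
  "outer3 u v w = (\<chi> i j k. u $ i * v $ j * w $ k)"

definition tensor_cube :: "(real ^ 'm) set \<Rightarrow> (real ^ 'm ^ 'm ^ 'm) set" where
  "tensor_cube W = span {outer3 u v w | u v w. u \<in> W \<and> v \<in> W \<and> w \<in> W}"

definition symmetrically_concise :: "real ^ 'm ^ 'm ^ 'm \<Rightarrow> bool" where
  "symmetrically_concise C \<longleftrightarrow> \<not> (\<exists>W. subspace W \<and> W \<noteq> UNIV \<and> C \<in> tensor_cube W)"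

definition rank_one :: "real ^ 'm ^ 'm ^ 'm \<Rightarrow> bool" where
  "rank_one T \<longleftrightarrow> (\<exists>u v w. u \<noteq> 0 \<and> v \<noteq> 0 \<and> w \<noteq> 0 \<and> T = outer3 u v w)"

text \<open>Decompositions are multisets of rank one tensors, i.e. sums of terms up to re-ordering.\<close>

definition decomposition :: "real ^ 'm ^ 'm ^ 'm \<Rightarrow> (real ^ 'm ^ 'm ^ 'm) multiset \<Rightarrow> bool" where
  "decomposition C D \<longleftrightarrow> (\<forall>T \<in># D. rank_one T) \<and> sum_mset D = C"

definition tensor_rank :: "real ^ 'm ^ 'm ^ 'm \<Rightarrow> nat" where
  "tensor_rank C = (LEAST n. \<exists>D. decomposition C D \<and> size D = n)"

definition minimal_decompositions ::
  "real ^ 'm ^ 'm ^ 'm \<Rightarrow> (real ^ 'm ^ 'm ^ 'm) multiset set" where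
  "minimal_decompositions C = {D. decomposition C D \<and> size D = tensor_rank C}"

definition zariski_closed :: "('a::real_normed_vector) set \<Rightarrow> bool" where
  "zariski_closed Z \<longleftrightarrow>
     (\<exists>P. (\<forall>p\<in>P. real_polynomial_function p) \<and> Z = {x. \<forall>p\<in>P. p x = 0})"

text \<open>
  Meant for finite-dimensional spaces, where \<^const>\<open>real_polynomial_function\<close> describes exactly
  the polynomials in the coordinates.
\<close>

definition for_generic :: "(('a::real_normed_vector) \<Rightarrow> bool) \<Rightarrow> bool" where
  "for_generic Q \<longleftrightarrow> (\<exists>Z. zariski_closed Z \<and> Z \<noteq> UNIV \<and> (\<forall>x. x \<notin> Z \<longrightarrow> Q x))"

end

(* Write C for the core tensor, l = psi(1) - psi(0) and H for the group of matrices A with A.C = C.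

   For generic X the matrix X has a left inverse L, and symmetric conciseness gives Y = X (L Y) with
   L Y in H for every Y with the same tensor. So it suffices to bound |H| by delta r!/(r-m)!.

   The shuffle relations express the symmetrized tensors C_ijk + C_jik + C_jki as l_i S_jk, where S is
   the second level signature. In particular C_iii = l_i^3/6, so that H fixes l, which is non-zero.

   Finiteness of the number of minimal decompositions enters as follows. Two terms of a minimal
   decomposition never share a vector in the same slot, since u (x) v (x) w + u (x) v' (x) w' can be
   rewritten in infinitely many ways. If G in H fixes every term of a decomposition D, then D is
   graded by the eigenvalues of G, and for eigenvalues other than 1 and -1 the shuffle relations turn
   the component of type (a,b,c) into a permutation of another component, up to sign. Decomposing the
   one like the other produces two terms that share a vector. Hence all eigenvalues are 1 or -1. A
   similar argument with transvections gives m <= r.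

   H permutes the minimal decompositions, so |H| <= delta |N| for the stabilizer N of one of them. For a
   subgroup of N, look at the dimension of its fixed space, which contains l. Passing to the
   stabilizer of a term that is moved costs a factor at most r - a, if a terms are fixed already;
   passing to the fixer of a vector of a fixed term costs a factor 2. Every step enlarges the fixed
   space, and |N| <= r!/(r-m)! follows. *)

theory Submission
  imports Defs "HOL-Combinatorics.Cycles"
begin

section \<open>Shuffle relations for the iterated integrals\<close>

text \<open>Here \<open>h\<close> is integrable only in the Henstock-Kurzweil sense and
  \<open>y\<close> need not be differentiable everywhere, so the product rule does not apply.
  Riemann sums are compared with the telescoping sum of \<open>f * y\<close>. The error splits into
  Henstock's error for \<open>h\<close>, the linearization error of \<open>f\<close>, and products
  of increments of \<open>f\<close> and \<open>y\<close>.\<close>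

lemma has_integral_by_parts_HK:
  fixes f f' y h :: "real \<Rightarrow> real"
  assumes "a \<le> b"
    and derf: "\<And>x. x \<in> {a..b} \<Longrightarrow> (f has_vector_derivative f' x) (at x within {a..b})"
    and h: "h integrable_on {a..b}"
    and y: "\<And>u v. a \<le> u \<Longrightarrow> u \<le> v \<Longrightarrow> v \<le> b \<Longrightarrow> y v - y u = integral {u..v} h"
  shows "((\<lambda>t. f t * h t + f' t * y t) has_integral (f b * y b - f a * y a)) {a..b}"
proof -
  have contf: "continuous_on {a..b} f"
    using derf has_vector_derivative_continuous continuous_on_eq_continuous_within by blast
  have "continuous_on {a..b} (\<lambda>t. y a + integral {a..t} h)"
    by (intro continuous_intros indefinite_integral_continuous_1 h)
  moreover have "y t = y a + integral {a..t} h" if "t \<in> {a..b}" for t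
    using y[of a t] that by auto
  ultimately have conty: "continuous_on {a..b} y"
    by (metis (no_types, lifting) continuous_on_cong)
  have "bounded (f ` {a..b})" "bounded (y ` {a..b})"
    using contf conty compact_continuous_image compact_imp_bounded by blast+
  then obtain M1 M2 where M1: "\<And>t. t \<in> {a..b} \<Longrightarrow> \<bar>f t\<bar> \<le> M1" and M2: "\<And>t. t \<in> {a..b} \<Longrightarrow> \<bar>y t\<bar> \<le> M2"
    unfolding bounded_iff by (metis image_eqI real_norm_def)
  define M where "M = \<bar>M1\<bar> + \<bar>M2\<bar>"
  have M: "\<bar>f t\<bar> \<le> M" "\<bar>y t\<bar> \<le> M" if "t \<in> {a..b}" for t
    using M1[OF that] M2[OF that] unfolding M_def by auto
  have "M \<ge> 0" unfolding M_def by simp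
  have "((\<lambda>t. f t * h t + f' t * y t) has_integral (f b * y b - f a * y a)) (cbox a b)"
    unfolding has_integral
  proof safe
    fix E :: real assume "E > 0"
    \<comment> \<open>The errors add up to at most \<open>M * e + (M * e + e) * (b - a)\<close>; the
      summand 1 makes the final bound strict.\<close>
    define e where "e = E / (M + M * (b - a) + (b - a) + 1)"
    have den: "M + M * (b - a) + (b - a) + 1 > 0"
      using \<open>M \<ge> 0\<close> \<open>a \<le> b\<close> by (simp add: add_nonneg_pos)
    have "e > 0" unfolding e_def using \<open>E > 0\<close> den by simp
    have eE: "e * (M + M * (b - a) + (b - a)) < E"
    proof -
      have "e * (M + M * (b - a) + (b - a)) < e * (M + M * (b - a) + (b - a) + 1)"
        using \<open>e > 0\<close> by (simp add: algebra_simps)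
      also have "\<dots> = E" unfolding e_def using den by simp
      finally show ?thesis .
    qed
    obtain \<gamma> where \<gamma>: "gauge \<gamma>"
      and hen: "\<And>p. \<lbrakk>p tagged_partial_division_of (cbox a b); \<gamma> fine p\<rbrakk> \<Longrightarrow>
             sum (\<lambda>(x,k). norm(measure lborel k *\<^sub>R h x - integral k h)) p < e"
      using Henstock_lemma[of h a b e] h \<open>e > 0\<close> by auto
    \<comment> \<open>The increment of \<open>y\<close> is weighed against the slope of
      \<open>f\<close> at \<open>x\<close>, which need not be bounded in \<open>x\<close>, so that
      the product of the two increments is at most \<open>e * \<bar>s - x\<bar>\<close>.\<close>
    have "\<exists>d>0. x \<in> {a..b} \<longrightarrow> (\<forall>s\<in>{a..b}. \<bar>s - x\<bar> < d \<longrightarrow>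
        \<bar>f s - f x - (s - x) * f' x\<bar> \<le> e * \<bar>s - x\<bar> \<and> \<bar>y s - y x\<bar> \<le> e / (\<bar>f' x\<bar> + e))" for x
    proof (cases "x \<in> {a..b}")
      case True
      obtain d1 where d1: "d1 > 0" "\<And>s. s\<in>{a..b} \<Longrightarrow> \<bar>s - x\<bar> < d1 \<Longrightarrow>
          \<bar>f s - f x - (s - x) * f' x\<bar> \<le> e * \<bar>s - x\<bar>"
        using derf[OF True, unfolded has_vector_derivative_def has_derivative_within_alt] \<open>e > 0\<close>
        by (auto simp: real_norm_def)
      have "e / (\<bar>f' x\<bar> + e) > 0" using \<open>e > 0\<close> by simp
      then obtain d2 where d2: "d2 > 0" "\<And>s. s\<in>{a..b} \<Longrightarrow> \<bar>s - x\<bar> < d2 \<Longrightarrow> \<bar>y s - y x\<bar> \<le> e / (\<bar>f' x\<bar> + e)"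
        using conty True unfolding continuous_on_iff dist_real_def by (metis less_imp_le)
      show ?thesis
        by (rule exI[of _ "min d1 d2"]) (use d1 d2 in auto)
    qed (auto intro: exI[of _ 1])
    then obtain d where d: "\<And>x. d x > 0"
      "\<And>x s. x \<in> {a..b} \<Longrightarrow> s \<in> {a..b} \<Longrightarrow> \<bar>s - x\<bar> < d x \<Longrightarrow> \<bar>f s - f x - (s - x) * f' x\<bar> \<le> e * \<bar>s - x\<bar>"
      "\<And>x s. x \<in> {a..b} \<Longrightarrow> s \<in> {a..b} \<Longrightarrow> \<bar>s - x\<bar> < d x \<Longrightarrow> \<bar>y s - y x\<bar> \<le> e / (\<bar>f' x\<bar> + e)"
      by metis
    show "\<exists>\<gamma>. gauge \<gamma> \<and> (\<forall>p. p tagged_division_of (cbox a b) \<and> \<gamma> fine p \<longrightarrow>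
        norm ((\<Sum>(x, k)\<in>p. measure lborel k *\<^sub>R (f x * h x + f' x * y x)) - (f b * y b - f a * y a)) < E)"
    proof (rule exI[of _ "\<lambda>x. \<gamma> x \<inter> ball x (d x)"], safe)
      show "gauge (\<lambda>x. \<gamma> x \<inter> ball x (d x))"
        by (intro gauge_Int \<gamma> gauge_ball_dependent) (use d(1) in auto)
    next
      fix p assume ptag: "p tagged_division_of cbox a b" and fine: "(\<lambda>x. \<gamma> x \<inter> ball x (d x)) fine p"
      have fine1: "\<gamma> fine p" and fine2: "(\<lambda>x. ball x (d x)) fine p"
        using fine by (auto simp: fine_def)
      let ?F = "\<lambda>t. f t * y t"
      have tele: "?F b - ?F a = (\<Sum>(x,K)\<in>p. ?F (Sup K) - ?F (Inf K))"
         "b - a = (\<Sum>(x,K)\<in>p. Sup K - Inf K)"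
        using additive_tagged_division_1[where f= ?F] additive_tagged_division_1[where f= "\<lambda>x. x"] \<open>a \<le> b\<close> ptag by auto
      have "norm (\<Sum>(x,K)\<in>p. measure lborel K *\<^sub>R (f x * h x + f' x * y x) - (?F (Sup K) - ?F (Inf K)))
         \<le> (\<Sum>z\<in>p. M * (case z of (x,K) \<Rightarrow> norm (measure lborel K *\<^sub>R h x - integral K h)) + (M * e + e) * (case z of (x,K) \<Rightarrow> Sup K - Inf K))"
      proof (rule sum_norm_le, safe)
        fix x K assume xK: "(x, K) \<in> p"
        then have "x \<in> K" and Kab: "K \<subseteq> cbox a b" using ptag by blast+
        then obtain u v where K: "K = cbox u v" using ptag xK by auto
        have uv: "u \<le> v" "u \<le> x" "x \<le> v" using \<open>x \<in> K\<close> by (auto simp: K)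
        then have uK: "u \<in> K" "v \<in> K" by (auto simp: K)
        then have mem: "u \<in> {a..b}" "v \<in> {a..b}" "x \<in> {a..b}" using Kab \<open>x \<in> K\<close> by auto
        have ball: "K \<subseteq> ball x (d x)" using fine2 xK by blast
        then have du: "\<bar>u - x\<bar> < d x" and dv: "\<bar>v - x\<bar> < d x"
          using uK by (auto simp: dist_real_def subset_iff)
        have pos: "\<bar>f' x\<bar> + e > 0" using \<open>e > 0\<close> by linarith
        have cross: "\<bar>(f s - f x) * (y s - y x)\<bar> \<le> e * \<bar>s - x\<bar>" if "s \<in> {a..b}" "\<bar>s - x\<bar> < d x" for s
        proof -
          have "\<bar>f s - f x\<bar> \<le> \<bar>(s - x) * f' x\<bar> + e * \<bar>s - x\<bar>"
            using d(2)[OF mem(3) that] by linarith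
          also have "\<dots> = (\<bar>f' x\<bar> + e) * \<bar>s - x\<bar>" unfolding abs_mult by algebra
          finally have "\<bar>f s - f x\<bar> * \<bar>y s - y x\<bar> \<le> ((\<bar>f' x\<bar> + e) * \<bar>s - x\<bar>) * (e / (\<bar>f' x\<bar> + e))"
            using d(3)[OF mem(3) that] by (intro mult_mono) (use pos in auto)
          also have "\<dots> = e * \<bar>s - x\<bar>" using pos by (simp add: field_simps)
          finally show ?thesis by (simp add: abs_mult)
        qed
        have yint: "integral K h = y v - y u"
          using y[of u v] mem uv by (simp add: K)
        \<comment> \<open>Both increments are expanded about the tag \<open>x\<close>; the three
          kinds of error are then bounded one by one.\<close>
        have id: "measure lborel K *\<^sub>R (f x * h x + f' x * y x) - (?F (Sup K) - ?F (Inf K)) =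
           f x * (measure lborel K *\<^sub>R h x - integral K h)
           - y x * ((f v - f x - (v - x) * f' x) - (f u - f x - (u - x) * f' x))
           - (f v - f x) * (y v - y x) + (f u - f x) * (y u - y x)"
          unfolding yint using uv by (simp add: K algebra_simps)
        have 1: "\<bar>f x * (measure lborel K *\<^sub>R h x - integral K h)\<bar> \<le> M * norm (measure lborel K *\<^sub>R h x - integral K h)"
          using M(1)[OF mem(3)] by (simp add: abs_mult mult_right_mono)
        have "\<bar>(f v - f x - (v - x) * f' x) - (f u - f x - (u - x) * f' x)\<bar> \<le> e * \<bar>v - x\<bar> + e * \<bar>u - x\<bar>"
          using d(2)[OF mem(3,1) du] d(2)[OF mem(3,2) dv] by linarith
        also have "\<dots> = e * (v - u)" using uv by (simp add: algebra_simps)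
        finally have "\<bar>y x\<bar> * \<bar>(f v - f x - (v - x) * f' x) - (f u - f x - (u - x) * f' x)\<bar> \<le> M * (e * (v - u))"
          using M(2)[OF mem(3)] \<open>M \<ge> 0\<close> by (intro mult_mono) auto
        then have 2: "\<bar>y x * ((f v - f x - (v - x) * f' x) - (f u - f x - (u - x) * f' x))\<bar> \<le> M * (e * (v - u))"
          by (simp add: abs_mult)
        have 3: "\<bar>(f v - f x) * (y v - y x)\<bar> + \<bar>(f u - f x) * (y u - y x)\<bar> \<le> e * (v - u)"
        proof -
          have "e * \<bar>v - x\<bar> + e * \<bar>u - x\<bar> = e * (v - u)" using uv by (simp add: algebra_simps)
          then show ?thesis using cross[OF mem(1) du] cross[OF mem(2) dv] by linarith
        qed
        have "\<bar>A - B - X + Z\<bar> \<le> a1 + b1 + c1" if "\<bar>A\<bar> \<le> a1" "\<bar>B\<bar> \<le> b1" "\<bar>X\<bar> + \<bar>Z\<bar> \<le> c1"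
          for A B X Z a1 b1 c1 :: real using that by linarith
        from this[OF 1 2 3] have "norm (measure lborel K *\<^sub>R (f x * h x + f' x * y x) - (?F (Sup K) - ?F (Inf K)))
          \<le> M * norm (measure lborel K *\<^sub>R h x - integral K h) + M * (e * (v - u)) + e * (v - u)"
          unfolding id real_norm_def .
        also have "\<dots> = M * norm (measure lborel K *\<^sub>R h x - integral K h) + (M * e + e) * (Sup K - Inf K)"
          using uv by (simp add: K algebra_simps)
        finally show "norm (measure lborel K *\<^sub>R (f x * h x + f' x * y x) - (?F (Sup K) - ?F (Inf K)))
          \<le> M * norm (measure lborel K *\<^sub>R h x - integral K h) + (M * e + e) * (Sup K - Inf K)" .
      qed
      also have "\<dots> = M * (\<Sum>(x,K)\<in>p. norm (measure lborel K *\<^sub>R h x - integral K h)) + (M * e + e) * (b - a)"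
        by (simp add: tele(2) sum.distrib sum_distrib_left)
      also have "\<dots> \<le> M * e + (M * e + e) * (b - a)"
        using hen[OF _ fine1] ptag \<open>M \<ge> 0\<close>
        by (intro add_right_mono mult_left_mono) (auto simp: tagged_division_of_def less_imp_le)
      also have "\<dots> < E" using eE by (simp add: algebra_simps)
      finally show "norm ((\<Sum>(x, k)\<in>p. measure lborel k *\<^sub>R (f x * h x + f' x * y x)) - (f b * y b - f a * y a)) < E"
        by (simp add: tele(1) sum_subtractf split_def)
    qed
  qed
  then show ?thesis by simp
qed


section \<open>The first two levels of a dictionary\<close>

lemma dictionary_has_derivative:
  fixes \<psi> :: "real \<Rightarrow> real ^ 'm"
  assumes "dictionary \<psi>"
  obtains S where "finite S"
    "\<And>x i. x \<in> {0<..<1} - S \<Longrightarrow> ((\<lambda>u. \<psi> u $ i) has_real_derivative deriv (\<lambda>u. \<psi> u $ i) x) (at x)"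
proof -
  have "\<forall>i. \<exists>S. finite S \<and> (\<forall>x\<in>{0..1} - S. (\<lambda>u. \<psi> u $ i) differentiable (at x within {0..1}))"
    using assms unfolding dictionary_def piecewise_differentiable_on_def by auto
  then obtain S where S: "\<And>i. finite (S i)"
      "\<And>i x. x \<in> {0..1} - S i \<Longrightarrow> (\<lambda>u. \<psi> u $ i) differentiable (at x within {0..1})"
    by metis
  show thesis
  proof (rule that[of "\<Union>i. S i"])
    show "finite (\<Union>i. S i)" using S(1) by simp
    fix x i assume "x \<in> {0<..<1} - (\<Union>i. S i)"
    then have "x \<in> {0..1} - S i" "0 < x" "x < 1" by auto
    then have "(\<lambda>u. \<psi> u $ i) differentiable (at x)"
      using S(2)[of x i] at_within_Icc_at[of 0 x 1] by simp
    then show "((\<lambda>u. \<psi> u $ i) has_real_derivative deriv (\<lambda>u. \<psi> u $ i) x) (at x)"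
      using DERIV_deriv_iff_real_differentiable by blast
  qed
qed

text \<open>The fundamental theorem for the Henstock-Kurzweil integral asks only for continuity and
  a derivative off a finite set, so no bound on the derivative enters.\<close>

lemma iterated1_dictionary:
  fixes \<psi> :: "real \<Rightarrow> real ^ 'm"
  assumes "dictionary \<psi>" and "t \<in> {0..1}"
  shows "iterated1 \<psi> i t = \<psi> t $ i - \<psi> 0 $ i"
proof -
  obtain S where S: "finite S"
    "\<And>x i. x \<in> {0<..<1} - S \<Longrightarrow> ((\<lambda>u. \<psi> u $ i) has_real_derivative deriv (\<lambda>u. \<psi> u $ i) x) (at x)"
    using dictionary_has_derivative[OF assms(1)] by blast
  have "continuous_on {0..1} (\<lambda>u. \<psi> u $ i)"
    using assms(1) unfolding dictionary_def piecewise_differentiable_on_def by auto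
  then have c: "continuous_on {0..t} (\<lambda>u. \<psi> u $ i)"
    by (rule continuous_on_subset) (use assms in auto)
  have "(deriv (\<lambda>u. \<psi> u $ i) has_integral (\<psi> t $ i - \<psi> 0 $ i)) {0..t}"
    by (rule fundamental_theorem_of_calculus_interior_strong[OF S(1) _ _ c])
      (use assms in \<open>auto intro!: S(2) simp flip: has_real_derivative_iff_has_vector_derivative\<close>)
  then show ?thesis unfolding iterated1_def by (rule integral_unique)
qed

lemma iterated1_continuous_on:
  assumes "dictionary \<psi>"
  shows "continuous_on {0..1} (iterated1 \<psi> i)"
proof -
  have "continuous_on {0..1} (\<lambda>u. \<psi> u $ i - \<psi> 0 $ i)"
    using assms unfolding dictionary_def piecewise_differentiable_on_def
    by (intro continuous_on_diff continuous_on_const) auto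
  then show ?thesis
    by (subst continuous_on_cong[OF refl iterated1_dictionary[OF assms]]) auto
qed

lemma iterated1_has_derivative:
  assumes "dictionary \<psi>" and "x \<in> {0<..<1}"
    and "((\<lambda>u. \<psi> u $ i) has_real_derivative D) (at x)"
  shows "(iterated1 \<psi> i has_real_derivative D) (at x)"
proof -
  have "((\<lambda>u. \<psi> u $ i - \<psi> 0 $ i) has_real_derivative D) (at x)"
    using DERIV_diff[OF assms(3) DERIV_const] by simp
  then show ?thesis
    by (rule has_field_derivative_transform_within_open[where S = "{0<..<1}"])
      (use assms in \<open>auto simp: iterated1_dictionary\<close>)
qed

text \<open>The product rule for two first level integrals, both differentiable off a finite set.
  That each summand is integrable by itself, and not just their sum, comes from
  \<open>has_core_tensor\<close>.\<close>

lemma iterated2_add_swap: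
  fixes \<psi> :: "real \<Rightarrow> real ^ 'm"
  assumes "dictionary \<psi>" and "has_core_tensor \<psi>" and t: "t \<in> {0..1}"
  shows "iterated2 \<psi> i j t + iterated2 \<psi> j i t = iterated1 \<psi> i t * iterated1 \<psi> j t"
proof -
  obtain S where S: "finite S"
    "\<And>x i. x \<in> {0<..<1} - S \<Longrightarrow> ((\<lambda>u. \<psi> u $ i) has_real_derivative deriv (\<lambda>u. \<psi> u $ i) x) (at x)"
    using dictionary_has_derivative[OF assms(1)] by blast
  let ?h = "\<lambda>i j s. iterated1 \<psi> i s * deriv (\<lambda>u. \<psi> u $ j) s"
  have int: "?h i j integrable_on {0..t}" for i j
    by (rule integrable_on_subinterval[of _ "{0..1}"]) (use assms in \<open>auto simp: has_core_tensor_def\<close>)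
  have "((\<lambda>s. ?h i j s + ?h j i s) has_integral
      (iterated1 \<psi> i t * iterated1 \<psi> j t - iterated1 \<psi> i 0 * iterated1 \<psi> j 0)) {0..t}"
  proof (rule fundamental_theorem_of_calculus_interior_strong[OF S(1)])
    show "continuous_on {0..t} (\<lambda>s. iterated1 \<psi> i s * iterated1 \<psi> j s)"
      by (intro continuous_intros continuous_on_subset[OF iterated1_continuous_on[OF assms(1)]])
        (use t in auto)
    fix x assume x: "x \<in> {0<..<t} - S"
    then have x': "x \<in> {0<..<1}" "x \<in> {0<..<1} - S" using t by auto
    show "((\<lambda>s. iterated1 \<psi> i s * iterated1 \<psi> j s) has_vector_derivative (?h i j x + ?h j i x)) (at x)"
      unfolding has_real_derivative_iff_has_vector_derivative[symmetric]
      using DERIV_mult[OF iterated1_has_derivative[OF assms(1) x'(1) S(2)[OF x'(2)], of i]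
         iterated1_has_derivative[OF assms(1) x'(1) S(2)[OF x'(2)], of j]]
      by (simp add: algebra_simps)
  qed (use t in auto)
  moreover have "iterated1 \<psi> i 0 = 0" by (simp add: iterated1_def)
  ultimately have "integral {0..t} (\<lambda>s. ?h i j s + ?h j i s) = iterated1 \<psi> i t * iterated1 \<psi> j t"
    by (simp add: integral_unique)
  then show ?thesis
    unfolding iterated2_def using integral_add[OF int int, of i j j i] by simp
qed

text \<open>The second level of the path need not be differentiable where the first level is, so that
  the product rule is not available. Integration by parts is applied away from the break points,
  and continuity bridges these.\<close>

lemma core_tensor_shuffle:
  fixes \<psi> :: "real \<Rightarrow> real ^ 'm"
  assumes "dictionary \<psi>" and "has_core_tensor \<psi>"
  shows "core_tensor \<psi> $ i $ j $ k + core_tensor \<psi> $ j $ i $ k + core_tensor \<psi> $ j $ k $ i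
    = (\<psi> 1 $ i - \<psi> 0 $ i) * iterated2 \<psi> j k 1"
proof -
  obtain S where S: "finite S"
    "\<And>x i. x \<in> {0<..<1} - S \<Longrightarrow> ((\<lambda>u. \<psi> u $ i) has_real_derivative deriv (\<lambda>u. \<psi> u $ i) x) (at x)"
    using dictionary_has_derivative[OF assms(1)] by blast
  let ?h = "\<lambda>s. iterated1 \<psi> j s * deriv (\<lambda>u. \<psi> u $ k) s"
  let ?c = "\<lambda>i j k s. iterated2 \<psi> i j s * deriv (\<lambda>u. \<psi> u $ k) s"
  let ?g = "\<lambda>s. ?c i j k s + ?c j i k s + ?c j k i s"
  let ?g' = "\<lambda>s. iterated1 \<psi> i s * ?h s + deriv (\<lambda>u. \<psi> u $ i) s * iterated2 \<psi> j k s"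
  have ch: "?h integrable_on {0..1}" and cint: "?c i j k integrable_on {0..1}" for i j k
    using assms(2) unfolding has_core_tensor_def by auto
  have gint: "?g integrable_on {0..1}" by (intro integrable_add cint)
  \<comment> \<open>By the second level relation the first two summands combine, and the integrand
    becomes the formal derivative of a product of level one and level two.\<close>
  have gg': "?g s = ?g' s" if "s \<in> {0..1}" for s
    using iterated2_add_swap[OF assms that, of i j] by (simp add: algebra_simps flip: distrib_right)
  let ?F = "\<lambda>t. integral {0..t} ?g - iterated1 \<psi> i t * iterated2 \<psi> j k t"
  have "continuous_on {0..1} (iterated2 \<psi> j k)"
    unfolding iterated2_def by (intro indefinite_integral_continuous_1 ch)
  then have contF: "continuous_on {0..1} ?F"
    by (intro continuous_intros indefinite_integral_continuous_1 gint iterated1_continuous_on assms)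
  have local: "?F v = ?F u" if uv: "0 < u" "u \<le> v" "v < 1" "{u..v} \<inter> S = {}" for u v
  proof -
    have "(?g' has_integral (iterated1 \<psi> i v * iterated2 \<psi> j k v - iterated1 \<psi> i u * iterated2 \<psi> j k u)) {u..v}"
    proof (rule has_integral_by_parts_HK)
      show "u \<le> v" by fact
      show "?h integrable_on {u..v}"
        by (rule integrable_on_subinterval[OF ch]) (use uv in auto)
      fix x assume "x \<in> {u..v}"
      then have x: "x \<in> {0<..<1}" "x \<in> {0<..<1} - S" using uv by auto
      show "(iterated1 \<psi> i has_vector_derivative deriv (\<lambda>u. \<psi> u $ i) x) (at x within {u..v})"
        using iterated1_has_derivative[OF assms(1) x(1) S(2)[OF x(2)], of i]
        by (simp add: has_real_derivative_iff_has_vector_derivative has_vector_derivative_at_within)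
    next
      fix u' v' assume "u \<le> u'" "u' \<le> v'" "v' \<le> v"
      then have "?h integrable_on {0..v'}"
        by (intro integrable_on_subinterval[OF ch]) (use uv in auto)
      then show "iterated2 \<psi> j k v' - iterated2 \<psi> j k u' = integral {u'..v'} ?h"
        unfolding iterated2_def
        using Henstock_Kurzweil_Integration.integral_combine[of 0 u' v' ?h] uv \<open>u \<le> u'\<close> \<open>u' \<le> v'\<close> by auto
    qed
    then have "integral {u..v} ?g' = iterated1 \<psi> i v * iterated2 \<psi> j k v - iterated1 \<psi> i u * iterated2 \<psi> j k u"
      by (rule integral_unique)
    moreover have "integral {u..v} ?g = integral {u..v} ?g'"
      by (rule integral_cong, rule gg') (use uv in auto)
    moreover have "?g integrable_on {0..v}"
      by (rule integrable_on_subinterval[OF gint]) (use uv in auto)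
    ultimately show ?thesis
      using Henstock_Kurzweil_Integration.integral_combine[of 0 u v ?g] uv by auto
  qed
  \<comment> \<open>Locally constant off a finite set and continuous, \<open>?F\<close> keeps its
    value 0 from the left end point.\<close>
  have "?F 1 = 0"
  proof (rule has_derivative_zero_unique_strong_interval[where f = ?F and k = "S \<union> {0,1}" and a = 0 and b = 1])
    show "finite (S \<union> {0,1})" using S(1) by simp
    show "continuous_on {0..1} ?F" by (rule contF)
    show "?F 0 = 0" by (simp add: iterated1_def)
    fix x :: real assume "x \<in> {0..1} - (S \<union> {0,1})"
    then have x: "0 < x" "x < 1" "x \<notin> S" by auto
    have "open (- (S \<union> {0,1}))" using S(1) by (intro open_Compl finite_imp_closed) simp
    then obtain e where e: "e > 0" "ball x e \<subseteq> - (S \<union> {0,1})"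
      using x by (elim openE[where x = x]) auto
    have *: "{min x t..max x t} \<inter> S = {}" "0 < min x t" "max x t < 1" if "t \<in> ball x e" for t
    proof -
      have sub: "{min x t..max x t} \<subseteq> ball x e"
        using that by (auto simp: dist_real_def)
      then show "{min x t..max x t} \<inter> S = {}" using e by blast
      have "0 \<notin> {min x t..max x t}" "1 \<notin> {min x t..max x t}" using sub e(2) by blast+
      then show "0 < min x t" "max x t < 1" using x by auto
    qed
    have const: "?F x = ?F t" if "t \<in> ball x e" for t
      using local[of "min x t" "max x t"] *[OF that]
      by (cases "x \<le> t") (auto simp: min_def max_def)
    have "(?F has_derivative (\<lambda>h. 0)) (at x)"
    proof (rule has_derivative_transform_within_open)
      show "((\<lambda>_. ?F x) has_derivative (\<lambda>h. 0)) (at x)" by (rule has_derivative_const)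
      show "open (ball x e)" "x \<in> ball x e" using e(1) by simp_all
    qed (rule const)
    then show "(?F has_derivative (\<lambda>h. 0)) (at x within {0..1})"
      by (rule has_derivative_at_withinI)
  qed auto
  moreover have "integral {0..1} ?g
      = core_tensor \<psi> $ i $ j $ k + core_tensor \<psi> $ j $ i $ k + core_tensor \<psi> $ j $ k $ i"
    unfolding core_tensor_def by (simp add: integral_add integrable_add cint)
  ultimately show ?thesis
    using iterated1_dictionary[OF assms(1), of 1 i] by simp
qed

section \<open>Tensors and their decompositions\<close>

definition trilin :: "real ^ 'm ^ 'm ^ 'm \<Rightarrow> real ^ 'm \<Rightarrow> real ^ 'm \<Rightarrow> real ^ 'm \<Rightarrow> real" where
  "trilin C f g h = (\<Sum>i\<in>UNIV. \<Sum>j\<in>UNIV. \<Sum>k\<in>UNIV. C $ i $ j $ k * f $ i * g $ j * h $ k)"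

lemma tensor_act_nth: "tensor_act C X Y Z $ a $ b $ c = trilin C (X $ a) (Y $ b) (Z $ c)"
  by (simp add: tensor_act_def trilin_def)

lemma trilin_add_left: "trilin C (f + f') g h = trilin C f g h + trilin C f' g h"
  by (simp add: trilin_def algebra_simps sum.distrib)

lemma trilin_add_middle: "trilin C f (g + g') h = trilin C f g h + trilin C f g' h"
  by (simp add: trilin_def algebra_simps sum.distrib)

lemma trilin_add_right: "trilin C f g (h + h') = trilin C f g h + trilin C f g h'"
  by (simp add: trilin_def algebra_simps sum.distrib)

lemma trilin_scaleR_left: "trilin C (c *\<^sub>R f) g h = c * trilin C f g h"
  by (simp add: trilin_def algebra_simps sum_distrib_left)

lemma trilin_scaleR_middle: "trilin C f (c *\<^sub>R g) h = c * trilin C f g h"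
  by (simp add: trilin_def algebra_simps sum_distrib_left)

lemma trilin_scaleR_right: "trilin C f g (c *\<^sub>R h) = c * trilin C f g h"
  by (simp add: trilin_def algebra_simps sum_distrib_left)

lemmas trilin_simps = trilin_add_left trilin_add_middle trilin_add_right
  trilin_scaleR_left trilin_scaleR_middle trilin_scaleR_right

lemma trilin_add_tensor: "trilin (C + D) f g h = trilin C f g h + trilin D f g h"
  by (simp add: trilin_def algebra_simps sum.distrib)

lemma sum_mult_axis: "(\<Sum>i\<in>UNIV. f i * axis a (1::real) $ i) = f a"
  by (simp add: axis_def if_distrib sum.delta cong: if_cong)

lemma trilin_axis: "trilin C (axis i 1) (axis j 1) (axis k 1) = C $ i $ j $ k"
proof -
  have "trilin C (axis i 1) (axis j 1) (axis k 1) = (\<Sum>i'\<in>UNIV. (\<Sum>j'\<in>UNIV. (\<Sum>k'\<in>UNIV. C $ i' $ j' $ k' * axis k 1 $ k') * axis j 1 $ j') * axis i 1 $ i')"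
    unfolding trilin_def by (simp add: sum_distrib_right sum_distrib_left algebra_simps)
  then show ?thesis by (simp only: sum_mult_axis)
qed

lemma tensor_eqI:
  assumes "\<And>i j k. C $ i $ j $ k = D $ i $ j $ k"
  shows "(C :: real ^ 'm ^ 'm ^ 'm) = D"
  using assms by (simp add: vec_eq_iff)

section \<open>Outer products\<close>

lemma outer3_nth [simp]: "outer3 u v w $ i $ j $ k = u $ i * v $ j * w $ k"
  by (simp add: outer3_def)

lemma trilin_outer3: "trilin (outer3 u v w) f g h = (f \<bullet> u) * (g \<bullet> v) * (h \<bullet> w)"
proof -
  have "trilin (outer3 u v w) f g h
    = (\<Sum>i\<in>UNIV. f $ i * u $ i * (\<Sum>j\<in>UNIV. g $ j * v $ j * (\<Sum>k\<in>UNIV. h $ k * w $ k)))"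
    unfolding trilin_def sum_distrib_left by (intro sum.cong refl) (simp add: algebra_simps)
  then show ?thesis
    unfolding sum_distrib_right[symmetric] inner_vec_def by simp
qed

lemma outer3_add_left: "outer3 (u + u') v w = outer3 u v w + outer3 u' v w"
  by (rule tensor_eqI) (simp add: algebra_simps)

lemma outer3_scaleR_left: "outer3 (c *\<^sub>R u) v w = c *\<^sub>R outer3 u v w"
  by (rule tensor_eqI) (simp add: algebra_simps)

lemma outer3_add_middle: "outer3 u (v + v') w = outer3 u v w + outer3 u v' w"
  by (rule tensor_eqI) (simp add: algebra_simps)

lemma outer3_scaleR_middle: "outer3 u (c *\<^sub>R v) w = c *\<^sub>R outer3 u v w"
  by (rule tensor_eqI) (simp add: algebra_simps)

lemma outer3_add_right: "outer3 u v (w + w') = outer3 u v w + outer3 u v w'"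
  by (rule tensor_eqI) (simp add: algebra_simps)

lemma outer3_scaleR_right: "outer3 u v (c *\<^sub>R w) = c *\<^sub>R outer3 u v w"
  by (rule tensor_eqI) (simp add: algebra_simps)

lemmas outer3_simps = outer3_add_left outer3_add_middle outer3_add_right
  outer3_scaleR_left outer3_scaleR_middle outer3_scaleR_right

lemma outer3_eq_0_iff: "outer3 u v w = 0 \<longleftrightarrow> u = 0 \<or> v = 0 \<or> w = 0"
proof
  assume *: "outer3 u v w = 0"
  show "u = 0 \<or> v = 0 \<or> w = 0"
  proof (rule ccontr)
    assume "\<not> (u = 0 \<or> v = 0 \<or> w = 0)"
    then obtain i j k where "u $ i \<noteq> 0" "v $ j \<noteq> 0" "w $ k \<noteq> 0"
      by (auto simp: vec_eq_iff)
    then have "outer3 u v w $ i $ j $ k \<noteq> 0" by simp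
    then show False unfolding * by simp
  qed
next
  assume "u = 0 \<or> v = 0 \<or> w = 0"
  then show "outer3 u v w = 0"
    by (intro tensor_eqI) (elim disjE; simp)
qed

lemma rank_one_outer3 [simp]: "rank_one (outer3 u v w) \<longleftrightarrow> u \<noteq> 0 \<and> v \<noteq> 0 \<and> w \<noteq> 0"
proof
  assume "rank_one (outer3 u v w)"
  then obtain u' v' w' where "u' \<noteq> 0" "v' \<noteq> 0" "w' \<noteq> 0" "outer3 u v w = outer3 u' v' w'"
    unfolding rank_one_def by blast
  then have "outer3 u v w \<noteq> 0" by (simp only: outer3_eq_0_iff) simp
  then show "u \<noteq> 0 \<and> v \<noteq> 0 \<and> w \<noteq> 0" by (simp add: outer3_eq_0_iff)
qed (auto simp: rank_one_def)

text \<open>Freezing two slots at indices where the factors do not vanish shows that the factors in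
  the third slot are proportional; the entry at these indices gives the product of the
  scalars.\<close>

lemma outer3_eqE:
  assumes "outer3 u v w = outer3 u' v' w'" "u \<noteq> 0" "v \<noteq> 0" "w \<noteq> 0"
  obtains a b c where "u' = a *\<^sub>R u" "v' = b *\<^sub>R v" "w' = c *\<^sub>R w" "a * b * c = 1"
proof -
  obtain i j k where nz: "u $ i \<noteq> 0" "v $ j \<noteq> 0" "w $ k \<noteq> 0"
    using assms(2-4) by (auto simp: vec_eq_iff)
  have eq: "u $ p * v $ q * w $ s = u' $ p * v' $ q * w' $ s" for p q s
    using assms(1) by (metis outer3_nth)
  have nz': "u' $ i \<noteq> 0" "v' $ j \<noteq> 0" "w' $ k \<noteq> 0"
    using eq[of i j k] nz by auto
  define a where "a = v $ j * w $ k / (v' $ j * w' $ k)"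
  define b where "b = u $ i * w $ k / (u' $ i * w' $ k)"
  define c where "c = u $ i * v $ j / (u' $ i * v' $ j)"
  show thesis
  proof
    show "u' = a *\<^sub>R u"
      using eq[of _ j k] nz' by (auto simp: vec_eq_iff a_def field_simps)
    show "v' = b *\<^sub>R v"
      using eq[of i _ k] nz' by (auto simp: vec_eq_iff b_def field_simps)
    show "w' = c *\<^sub>R w"
      using eq[of i j _] nz' by (auto simp: vec_eq_iff c_def field_simps)
    have "u' $ i = a * u $ i" "v' $ j = b * v $ j" "w' $ k = c * w $ k"
      using \<open>u' = a *\<^sub>R u\<close> \<open>v' = b *\<^sub>R v\<close> \<open>w' = c *\<^sub>R w\<close> by simp_all
    then have "u $ i * v $ j * w $ k = (a * b * c) * (u $ i * v $ j * w $ k)"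
      using eq[of i j k] by (simp add: algebra_simps)
    then show "a * b * c = 1" using nz by simp
  qed
qed

lemma tensor_expand:
  fixes C :: "real ^ 'm ^ 'm ^ 'm"
  shows "C = (\<Sum>i\<in>UNIV. \<Sum>j\<in>UNIV. \<Sum>k\<in>UNIV. outer3 (C $ i $ j $ k *\<^sub>R axis i 1) (axis j 1) (axis k 1))"
proof (rule tensor_eqI)
  fix a b c
  have "(\<Sum>i\<in>UNIV. \<Sum>j\<in>UNIV. \<Sum>k\<in>UNIV. outer3 (C $ i $ j $ k *\<^sub>R axis i 1) (axis j 1) (axis k 1)) $ a $ b $ c =
    (\<Sum>i\<in>UNIV. (\<Sum>j\<in>UNIV. (\<Sum>k\<in>UNIV. C $ i $ j $ k * axis c 1 $ k) * axis b 1 $ j) * axis a 1 $ i)"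
    by (simp add: sum_distrib_right sum_distrib_left algebra_simps axis_def eq_commute cong: if_cong)
  then show "C $ a $ b $ c = (\<Sum>i\<in>UNIV. \<Sum>j\<in>UNIV. \<Sum>k\<in>UNIV. outer3 (C $ i $ j $ k *\<^sub>R axis i 1) (axis j 1) (axis k 1)) $ a $ b $ c"
    by (simp only: sum_mult_axis)
qed

text \<open>The coefficients of the basis expansion are absorbed into first factors, so no case for
  scalar multiples arises.\<close>

lemma tensor_induct [case_names outer add]:
  fixes C :: "real ^ 'm ^ 'm ^ 'm"
  assumes outer: "\<And>u v w. P (outer3 u v w)" and add: "\<And>S T. P S \<Longrightarrow> P T \<Longrightarrow> P (S + T)"
  shows "P C"
proof -
  have "P 0" using outer[of 0 0 0] by (metis outer3_eq_0_iff)
  then have sum: "P (\<Sum>i\<in>A. f i)" if "\<And>i. P (f i)" for A and f :: "'m \<Rightarrow> real ^ 'm ^ 'm ^ 'm"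
    using that by (induction A rule: infinite_finite_induct) (auto intro: add)
  show ?thesis
    by (subst tensor_expand) (intro sum outer)
qed

section \<open>Matrices acting on tensors\<close>

lemma tensor_act_add: "tensor_act (C + D) X Y Z = tensor_act C X Y Z + tensor_act D X Y Z"
  by (rule tensor_eqI) (simp add: tensor_act_nth trilin_add_tensor)

lemma tensor_act_zero [simp]: "tensor_act 0 X Y Z = 0"
  by (rule tensor_eqI) (simp add: tensor_act_nth trilin_def)

lemma tensor_act_sum_mset:
  "tensor_act (sum_mset D) X Y Z = (\<Sum>T\<in>#D. tensor_act T X Y Z)"
  by (induction D) (simp_all add: tensor_act_add)

lemma tensor_act_outer3: "tensor_act (outer3 u v w) X Y Z = outer3 (X *v u) (Y *v v) (Z *v w)"
  by (rule tensor_eqI) (simp add: tensor_act_nth trilin_outer3 matrix_vector_mul_component)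

lemma tensor_act_tensor_act:
  "tensor_act (tensor_act C X Y Z) X' Y' Z' = tensor_act C (X' ** X) (Y' ** Y) (Z' ** Z)"
  by (induction C rule: tensor_induct)
    (simp_all add: tensor_act_add tensor_act_outer3 matrix_vector_mul_assoc)

lemma tensor_act_mat_1 [simp]: "tensor_act C (mat 1) (mat 1) (mat 1) = C"
  by (induction C rule: tensor_induct) (simp_all add: tensor_act_add tensor_act_outer3)

lemma rank_one_tensor_act:
  assumes "rank_one T" "invertible X" "invertible Y" "invertible Z"
  shows "rank_one (tensor_act T X Y Z)"
proof -
  have "X *v x \<noteq> 0" if "invertible X" "x \<noteq> 0" for X :: "real ^ 'a ^ 'b" and x
    using that by (metis inj_matrix_vector_mult injD matrix_vector_mult_0_right)
  then show ?thesis
    using assms unfolding rank_one_def by (auto simp: tensor_act_outer3 simp del: rank_one_outer3) blast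
qed

lemma tensor_cube_range:
  "tensor_act C A A A \<in> tensor_cube (range ((*v) A))"
proof (induction C rule: tensor_induct)
  case (outer u v w)
  then show ?case unfolding tensor_cube_def tensor_act_outer3 by (intro span_base) blast
next
  case (add S T)
  then show ?case unfolding tensor_cube_def tensor_act_add by (rule span_add)
qed

lemma sum_mset_in_tensor_cube:
  assumes "\<And>T. T \<in># D \<Longrightarrow> \<exists>u v w. T = outer3 u v w \<and> u \<in> W \<and> v \<in> W \<and> w \<in> W"
  shows "sum_mset D \<in> tensor_cube W"
  using assms
proof (induction D)
  case empty
  then show ?case by (simp add: tensor_cube_def span_zero)
next
  case (add T D)
  then have "T \<in> tensor_cube W" "sum_mset D \<in> tensor_cube W"
    unfolding tensor_cube_def by (auto intro!: span_base)
  then show ?case unfolding tensor_cube_def by (simp add: span_add)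
qed

section \<open>Existence of minimal decompositions and consequences of conciseness\<close>

lemma decomposition_exists: "\<exists>D. decomposition C D"
proof (induction C rule: tensor_induct)
  case (outer u v w)
  show ?case
  proof (cases "rank_one (outer3 u v w)")
    case True
    then have "decomposition (outer3 u v w) {#outer3 u v w#}" by (simp add: decomposition_def)
    then show ?thesis ..
  next
    case False
    then have "outer3 u v w = 0" by (auto simp: outer3_eq_0_iff)
    then have "decomposition (outer3 u v w) {#}" by (simp add: decomposition_def)
    then show ?thesis ..
  qed
next
  case (add S T)
  then obtain D E where "decomposition S D" "decomposition T E" by blast
  then have "decomposition (S + T) (D + E)" by (auto simp: decomposition_def)
  then show ?case ..
qed

lemma minimal_decompositions_nonempty: "minimal_decompositions C \<noteq> {}"
proof -
  have "\<exists>n D. decomposition C D \<and> size D = n" using decomposition_exists[of C] by blast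
  then have "\<exists>D. decomposition C D \<and> size D = tensor_rank C"
    unfolding tensor_rank_def by (rule LeastI_ex)
  then show ?thesis unfolding minimal_decompositions_def by blast
qed

lemma tensor_rank_le: "decomposition C D \<Longrightarrow> tensor_rank C \<le> size D"
  unfolding tensor_rank_def by (rule Least_le) blast

text \<open>Acting term by term keeps the sum, the number of terms and, by invertibility, rank one.
  This is the action of the stabilizer on the minimal decompositions.\<close>

lemma image_mset_minimal_decompositions:
  assumes "D \<in> minimal_decompositions C" "invertible A" "tensor_act C A A A = C"
  shows "image_mset (\<lambda>T. tensor_act T A A A) D \<in> minimal_decompositions C"
proof -
  have "sum_mset (image_mset (\<lambda>T. tensor_act T A A A) D) = C"
    using assms by (simp add: minimal_decompositions_def decomposition_def tensor_act_sum_mset[symmetric])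
  then show ?thesis
    using assms unfolding minimal_decompositions_def decomposition_def
    by (auto intro!: rank_one_tensor_act)
qed

text \<open>A functional that kills every slot would confine the tensor to the cube of its
  kernel.\<close>

lemma symmetrically_concise_functional:
  fixes C :: "real ^ 'm ^ 'm ^ 'm"
  assumes "symmetrically_concise C"
    and "\<And>g h. trilin C f g h = 0" "\<And>g h. trilin C g f h = 0" "\<And>g h. trilin C g h f = 0"
  shows "f = 0"
proof (rule ccontr)
  assume "f \<noteq> 0"
  define x where "x = (1 / (f \<bullet> f)) *\<^sub>R f"
  have fx: "f \<bullet> x = 1" using \<open>f \<noteq> 0\<close> by (simp add: x_def)
  \<comment> \<open>The projection onto the kernel of \<open>f\<close> along \<open>x\<close>, given
    by its rows. Each row differs from a coordinate functional by a multiple of \<open>f\<close>,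
    hence \<open>P\<close> fixes \<open>C\<close>.\<close>
  define P :: "real ^ 'm ^ 'm" where "P = (\<chi> a. axis a 1 + (- x $ a) *\<^sub>R f)"
  have "tensor_act C P P P = C"
    by (rule tensor_eqI) (simp add: tensor_act_nth P_def trilin_simps assms trilin_axis del: scaleR_minus_left)
  then have "C \<in> tensor_cube (range ((*v) P))" using tensor_cube_range[of C P] by simp
  moreover have "subspace (range ((*v) P))"
    by (simp add: linear_subspace_image)
  ultimately have "range ((*v) P) = UNIV"
    using assms(1) unfolding symmetrically_concise_def by blast
  then obtain z where z: "x = P *v z" by (metis UNIV_I imageE)
  have "(P *v z) $ a = z $ a - x $ a * (f \<bullet> z)" for a
    by (simp add: matrix_vector_mul_component P_def inner_axis' inner_diff_left)
  then have "P *v z = z - (f \<bullet> z) *\<^sub>R x" by (simp add: vec_eq_iff algebra_simps)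
  then have "f \<bullet> (P *v z) = 0" using fx by (simp add: inner_diff_right)
  then show False using z fx by simp
qed

lemma symmetrically_concise_invertible:
  fixes C :: "real ^ 'm ^ 'm ^ 'm" and A :: "real ^ 'm ^ 'm"
  assumes "symmetrically_concise C" "tensor_act C A A A = C"
  shows "invertible A"
proof -
  have "C \<in> tensor_cube (range ((*v) A))" using tensor_cube_range[of C A] assms(2) by simp
  moreover have "subspace (range ((*v) A))"
    by (simp add: linear_subspace_image)
  ultimately have "range ((*v) A) = UNIV"
    using assms(1) unfolding symmetrically_concise_def by blast
  then show ?thesis
    using invertible_right_inverse matrix_right_invertible_surjective by blast
qed

section \<open>Minimal decompositions, if there are finitely many\<close>

text \<open>Exchanging \<open>E\<close> for a smaller \<open>E'\<close> would give a decomposition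
  of \<open>C\<close> below the rank.\<close>

lemma tensor_rank_le_size_replace:
  assumes D: "D \<in> minimal_decompositions C" and "E \<subseteq># D" and "decomposition (sum_mset E) E'"
  shows "size E \<le> size E'"
proof -
  have dec: "decomposition C (D - E + E')"
  proof -
    have "sum_mset (D - E) + sum_mset E = sum_mset D"
      using \<open>E \<subseteq># D\<close> by (metis subset_mset.diff_add sum_mset.union)
    moreover have "T \<in># D" if "T \<in># D - E" for T using that by (rule in_diffD)
    ultimately show ?thesis
      using D assms(3) unfolding minimal_decompositions_def decomposition_def by auto
  qed
  have "size D \<le> size (D - E + E')"
    using D tensor_rank_le[OF dec] unfolding minimal_decompositions_def by simp
  also have "\<dots> = size D - size E + size E'"
    by (simp only: size_union size_Diff_submset[OF \<open>E \<subseteq># D\<close>])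
  finally show ?thesis using size_mset_mono[OF \<open>E \<subseteq># D\<close>] by linarith
qed

lemma minimal_decompositions_replace:
  assumes D: "D \<in> minimal_decompositions C" and "E \<subseteq># D" and "decomposition (sum_mset E) E'"
    and "size E' = size E"
  shows "D - E + E' \<in> minimal_decompositions C"
proof -
  have "sum_mset (D - E) + sum_mset E = sum_mset D"
    using \<open>E \<subseteq># D\<close> by (metis subset_mset.diff_add sum_mset.union)
  moreover have "T \<in># D" if "T \<in># D - E" for T using that by (rule in_diffD)
  moreover have "size (D - E + E') = size D"
    using assms(4) size_mset_mono[OF \<open>E \<subseteq># D\<close>] by (simp only: size_union size_Diff_submset[OF \<open>E \<subseteq># D\<close>])
  ultimately show ?thesis
    using D assms(3) unfolding minimal_decompositions_def decomposition_def by auto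
qed

lemma minimal_decompositions_sum_eq_0:
  assumes "D \<in> minimal_decompositions C" "E \<subseteq># D" "sum_mset E = 0"
  shows "E = {#}"
  using tensor_rank_le_size_replace[OF assms(1,2), of "{#}"] assms(3)
  by (simp add: decomposition_def)

text \<open>Each pair \<open>f t\<close>, \<open>g t\<close> may replace \<open>T\<close>,
  \<open>T'\<close>. Finitely many minimal decompositions contain only finitely many tensors, but
  injectivity yields infinitely many \<open>f t\<close>.\<close>

lemma infinite_family_of_pairs:
  fixes f g :: "real \<Rightarrow> real ^ 'm ^ 'm ^ 'm"
  assumes fin: "finite (minimal_decompositions C)" and D: "D \<in> minimal_decompositions C"
    and sub: "{#T, T'#} \<subseteq># D"
    and sum: "\<And>t. f t + g t = T + T'"
    and f: "\<And>t. f t = 0 \<or> rank_one (f t)" and g: "\<And>t. g t = 0 \<or> rank_one (g t)"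
    and "inj f"
  shows False
proof -
  \<comment> \<open>If one of the two vanished, dropping it would save a term and contradict
    minimality.\<close>
  have nz: "f t \<noteq> 0 \<and> g t \<noteq> 0" for t
  proof -
    let ?E = "filter_mset (\<lambda>T. T \<noteq> 0) {#f t, g t#}"
    have "sum_mset ?E = f t + g t" by auto
    then have "decomposition (sum_mset {#T, T'#}) ?E"
      using sum[of t] f[of t] g[of t] by (auto simp: decomposition_def)
    from tensor_rank_le_size_replace[OF D sub this] show ?thesis by (auto split: if_splits)
  qed
  have "f t \<in> \<Union>(set_mset ` minimal_decompositions C)" for t
  proof -
    have "decomposition (sum_mset {#T, T'#}) {#f t, g t#}"
      using nz[of t] f[of t] g[of t] sum[of t] by (auto simp: decomposition_def)
    then have "D - {#T, T'#} + {#f t, g t#} \<in> minimal_decompositions C"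
      by (intro minimal_decompositions_replace[OF D sub]) simp_all
    moreover have "f t \<in># D - {#T, T'#} + {#f t, g t#}" by simp
    ultimately show ?thesis by blast
  qed
  then have "finite (range f)"
    using fin by (intro finite_subset[of "range f" "\<Union>(set_mset ` minimal_decompositions C)"]) auto
  then show False
    using \<open>inj f\<close> finite_imageD infinite_UNIV_char_0 by blast
qed

lemma inj_add_scaleR:
  assumes "(b :: 'a :: real_vector) \<noteq> 0"
  shows "inj (\<lambda>t. a + t *\<^sub>R b)"
  using assms by (auto simp: inj_def)

lemma outer3_zero_or_rank_one: "outer3 u v w = 0 \<or> rank_one (outer3 u v w)"
  by (simp add: outer3_eq_0_iff) blast

lemma subset_decomposition_nonzero:
  assumes "D \<in> minimal_decompositions C" "{#outer3 u v w, outer3 u' v' w'#} \<subseteq># D"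
  shows "u \<noteq> 0 \<and> v \<noteq> 0 \<and> w \<noteq> 0 \<and> u' \<noteq> 0 \<and> v' \<noteq> 0 \<and> w' \<noteq> 0"
proof -
  have "outer3 u v w \<in># D" "outer3 u' v' w' \<in># D"
    using mset_subset_eqD[OF assms(2)] by auto
  then have "rank_one (outer3 u v w)" "rank_one (outer3 u' v' w')"
    using assms(1) by (auto simp: minimal_decompositions_def decomposition_def simp del: rank_one_outer3)
  then show ?thesis by simp
qed

text \<open>With a common first factor, a multiple of \<open>outer3 u v' w\<close> can be moved
  between the terms: it is absorbed by the second factor of one and by the third factor of the
  other. The next two lemmas do the same for the other slots.\<close>

lemma no_shared_left:
  assumes "finite (minimal_decompositions C)" "D \<in> minimal_decompositions C"
    and "{#outer3 u v w, outer3 u v' w'#} \<subseteq># D"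
  shows False
proof (rule infinite_family_of_pairs[OF assms, of "\<lambda>t. outer3 u (v + t *\<^sub>R v') w" "\<lambda>t. outer3 u v' (w' + (- t) *\<^sub>R w)"])
  have "outer3 u v' w \<noteq> 0" using subset_decomposition_nonzero[OF assms(2,3)] by (simp add: outer3_eq_0_iff)
  then show "inj (\<lambda>t. outer3 u (v + t *\<^sub>R v') w)"
    unfolding outer3_simps by (rule inj_add_scaleR)
qed ((simp only: outer3_simps, simp; fail), (rule outer3_zero_or_rank_one)+)

lemma no_shared_middle:
  assumes "finite (minimal_decompositions C)" "D \<in> minimal_decompositions C"
    and "{#outer3 u v w, outer3 u' v w'#} \<subseteq># D"
  shows False
proof (rule infinite_family_of_pairs[OF assms, of "\<lambda>t. outer3 (u + t *\<^sub>R u') v w" "\<lambda>t. outer3 u' v (w' + (- t) *\<^sub>R w)"])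
  have "outer3 u' v w \<noteq> 0" using subset_decomposition_nonzero[OF assms(2,3)] by (simp add: outer3_eq_0_iff)
  then show "inj (\<lambda>t. outer3 (u + t *\<^sub>R u') v w)"
    unfolding outer3_simps by (rule inj_add_scaleR)
qed ((simp only: outer3_simps, simp; fail), (rule outer3_zero_or_rank_one)+)

lemma no_shared_right:
  assumes "finite (minimal_decompositions C)" "D \<in> minimal_decompositions C"
    and "{#outer3 u v w, outer3 u' v' w#} \<subseteq># D"
  shows False
proof (rule infinite_family_of_pairs[OF assms, of "\<lambda>t. outer3 (u + t *\<^sub>R u') v w" "\<lambda>t. outer3 u' (v' + (- t) *\<^sub>R v) w"])
  have "outer3 u' v w \<noteq> 0" using subset_decomposition_nonzero[OF assms(2,3)] by (simp add: outer3_eq_0_iff)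
  then show "inj (\<lambda>t. outer3 (u + t *\<^sub>R u') v w)"
    unfolding outer3_simps by (rule inj_add_scaleR)
qed ((simp only: outer3_simps, simp; fail), (rule outer3_zero_or_rank_one)+)

text \<open>Two copies of a term would share all their vectors.\<close>

lemma minimal_decompositions_count_le_1:
  assumes "finite (minimal_decompositions C)" "D \<in> minimal_decompositions C"
  shows "count D T \<le> 1"
proof (rule ccontr)
  assume "\<not> count D T \<le> 1"
  then have "{#T, T#} \<subseteq># D" by (simp add: subseteq_mset_def)
  moreover have "T \<in># D" using \<open>\<not> count D T \<le> 1\<close> by (metis count_inI zero_le)
  then obtain u v w where "T = outer3 u v w"
    using assms(2) by (auto simp: minimal_decompositions_def decomposition_def rank_one_def)
  ultimately show False using no_shared_left[OF assms] by blast
qed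

text \<open>The image of \<open>E\<close> decomposes the sum of \<open>F\<close> and,
  \<open>\<phi>\<close> being an involution, the image of \<open>F\<close> decomposes the sum of
  \<open>E\<close>. Minimality forces equal sizes, and \<open>F\<close> may be exchanged for the
  image of \<open>E\<close>.\<close>

lemma minimal_decompositions_swap:
  assumes D: "D \<in> minimal_decompositions C" and sub: "E + F \<subseteq># D"
    and FE: "sum_mset F = \<phi> (sum_mset E)"
    and inv: "\<And>T. \<phi> (\<phi> T) = T" and add: "\<And>S T. \<phi> (S + T) = \<phi> S + \<phi> T"
    and rank_one: "\<And>T. rank_one T \<Longrightarrow> rank_one (\<phi> T)"
  shows "D - F + image_mset \<phi> E \<in> minimal_decompositions C"
proof -
  have E: "E \<subseteq># D" and F: "F \<subseteq># D"
    using sub by (meson mset_subset_eq_add_left mset_subset_eq_add_right subset_mset.order_trans)+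
  have "\<phi> 0 = 0" using add[of 0 0] by simp
  then have sum: "sum_mset (image_mset \<phi> M) = \<phi> (sum_mset M)" for M
    by (induction M) (simp_all add: add)
  have dec: "decomposition (\<phi> (sum_mset M)) (image_mset \<phi> M)" if "M \<subseteq># D" for M
    using D that mset_subset_eqD[OF that] rank_one
    by (auto simp: decomposition_def minimal_decompositions_def sum)
  have "size F \<le> size E"
    using tensor_rank_le_size_replace[OF D F] dec[OF E] FE by force
  moreover have "size E \<le> size F"
    using tensor_rank_le_size_replace[OF D E] dec[OF F] FE inv by force
  ultimately show ?thesis
    using minimal_decompositions_replace[OF D F, of "image_mset \<phi> E"] dec[OF E] FE by simp
qed

text \<open>\<open>E\<close> is disjoint from the part removed, so \<open>T\<close> survives next to
  its image. If \<open>\<phi>\<close> leaves one slot alone, the two share a vector.\<close>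

lemma minimal_decompositions_swap_pair:
  assumes "E + F \<subseteq># D" "T \<in># E"
  shows "{#T, \<phi> T#} \<subseteq># D - F + image_mset \<phi> E"
proof -
  have "E \<subseteq># D - F" using assms(1) by (simp add: subset_mset.le_diff_conv2 mset_subset_eq_add_right subset_mset.add_increasing
     subset_eq_diff_conv subseteq_mset_def)
     (metis add_le_imp_le_diff)
  then have "{#T#} \<subseteq># D - F" using assms(2) by (meson mset_subset_eq_single subset_mset.order_trans)
  moreover have "{#\<phi> T#} \<subseteq># image_mset \<phi> E" using assms(2) by (auto intro: mset_subset_eq_single)
  ultimately have "{#T#} + {#\<phi> T#} \<subseteq># D - F + image_mset \<phi> E" by (rule subset_mset.add_mono)
  then show ?thesis by (simp add: add_mset_commute)
qed

section \<open>The shuffle relations\<close>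

text \<open>A Lagrange interpolation polynomial in \<open>G\<close>, with value 1 at
  \<open>l\<close> and 0 at the other points of \<open>E\<close>, acting on eigenvectors.\<close>

lemma eigenspace_projection:
  fixes G :: "real ^ 'm ^ 'm"
  assumes "finite E"
  shows "\<exists>P :: real ^ 'm ^ 'm. \<forall>c\<in>E. \<forall>x. G *v x = c *\<^sub>R x \<longrightarrow> P *v x = (if c = l then x else 0)"
proof -
  have "\<exists>P :: real ^ 'm ^ 'm. \<forall>c x. G *v x = c *\<^sub>R x \<longrightarrow> P *v x = (\<Prod>k\<in>S. (c - k) / (l - k)) *\<^sub>R x"
    if "finite S" for S
    using that
  proof (induction S)
    case empty
    show ?case by (rule exI[of _ "mat 1"]) simp
  next
    case (insert k S)
    then obtain P :: "real ^ 'm ^ 'm"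
      where P: "\<And>c x. G *v x = c *\<^sub>R x \<Longrightarrow> P *v x = (\<Prod>k\<in>S. (c - k) / (l - k)) *\<^sub>R x"
      by blast
    \<comment> \<open>One more interpolation factor. For \<open>k = l\<close> this matrix and the
      matching scalar are both 0, as division by 0 gives 0; the set \<open>E - {l}\<close> used
      below avoids that case.\<close>
    let ?Q = "(1 / (l - k)) *\<^sub>R (G - k *\<^sub>R mat 1)"
    have "(P ** ?Q) *v x = (\<Prod>k\<in>insert k S. (c - k) / (l - k)) *\<^sub>R x" if "G *v x = c *\<^sub>R x" for c x
    proof -
      have "?Q *v x = ((c - k) / (l - k)) *\<^sub>R x"
        by (simp add: scaleR_matrix_vector_assoc[symmetric] matrix_vector_mult_diff_rdistrib that
            scaleR_diff_left diff_divide_distrib scaleR_diff_right)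
      then show ?thesis
        using insert.hyps P[OF that]
        by (simp add: matrix_vector_mul_assoc[symmetric] matrix_vector_mult_scaleR)
    qed
    then show ?case by blast
  qed
  from this[of "E - {l}"] obtain P :: "real ^ 'm ^ 'm"
    where P: "\<And>c x. G *v x = c *\<^sub>R x \<Longrightarrow> P *v x = (\<Prod>k\<in>E - {l}. (c - k) / (l - k)) *\<^sub>R x"
    using assms by auto
  have "P *v x = (if c = l then x else 0)" if "c \<in> E" "G *v x = c *\<^sub>R x" for c x
  proof (cases "c = l")
    case True
    then show ?thesis using P[OF that(2)] by (simp cong: prod.cong_simp)
  next
    case False
    then have "(\<Prod>k\<in>E - {l}. (c - k) / (l - k)) = 0"
      using assms that(1) by (intro prod_zero) auto
    then show ?thesis using P[OF that(2)] False by simp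
  qed
  then show ?thesis by blast
qed

section \<open>Shuffle relations of the trilinear form\<close>

lemma trilin_swap_left: "trilin C g f h = (\<Sum>i\<in>UNIV. \<Sum>j\<in>UNIV. \<Sum>k\<in>UNIV. C $ j $ i $ k * f $ i * g $ j * h $ k)"
  unfolding trilin_def by (subst sum.swap) (simp add: algebra_simps)

lemma trilin_rotate: "trilin C g h f = (\<Sum>i\<in>UNIV. \<Sum>j\<in>UNIV. \<Sum>k\<in>UNIV. C $ j $ k $ i * f $ i * g $ j * h $ k)"
proof -
  have "trilin C g h f = (\<Sum>j\<in>UNIV. \<Sum>i\<in>UNIV. \<Sum>k\<in>UNIV. C $ j $ k $ i * f $ i * g $ j * h $ k)"
    unfolding trilin_def by (rule sum.cong[OF refl], subst sum.swap) (simp add: algebra_simps)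
  also have "\<dots> = (\<Sum>i\<in>UNIV. \<Sum>j\<in>UNIV. \<Sum>k\<in>UNIV. C $ j $ k $ i * f $ i * g $ j * h $ k)"
    by (rule sum.swap)
  finally show ?thesis .
qed

text \<open>\<open>\<l>\<close> stands for the increment of the path and \<open>S\<close> for its
  second level. The terms of \<open>shuffle3\<close> insert the letter \<open>i\<close> at the three
  places of the word \<open>j k\<close>.\<close>

locale signature_tensor =
  fixes C :: "real ^ 'm ^ 'm ^ 'm" and \<l> :: "real ^ 'm" and S :: "real ^ 'm ^ 'm"
  assumes shuffle3: "C $ i $ j $ k + C $ j $ i $ k + C $ j $ k $ i = \<l> $ i * S $ j $ k"
    and shuffle2: "S $ i $ j + S $ j $ i = \<l> $ i * \<l> $ j"
    and not_loop: "\<l> \<noteq> 0"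
    and concise: "symmetrically_concise C"
    and finite_minimal_decompositions: "finite (minimal_decompositions C)"
begin

lemma trilin_shuffle:
  "trilin C f g h + trilin C g f h + trilin C g h f = (f \<bullet> \<l>) * (g \<bullet> (S *v h))"
proof -
  have "trilin C f g h + trilin C g f h + trilin C g h f =
    (\<Sum>i\<in>UNIV. \<Sum>j\<in>UNIV. \<Sum>k\<in>UNIV. (C $ i $ j $ k + C $ j $ i $ k + C $ j $ k $ i) * f $ i * g $ j * h $ k)"
    unfolding trilin_swap_left[of C g f h] trilin_rotate[of C g h f] trilin_def[of C f g h]
    by (simp add: sum.distrib[symmetric] distrib_right)
  also have "\<dots> = (\<Sum>i\<in>UNIV. f $ i * \<l> $ i * (\<Sum>j\<in>UNIV. g $ j * (\<Sum>k\<in>UNIV. S $ j $ k * h $ k)))"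
    unfolding shuffle3 sum_distrib_left by (intro sum.cong refl) (simp add: algebra_simps)
  also have "\<dots> = (f \<bullet> \<l>) * (g \<bullet> (S *v h))"
    unfolding sum_distrib_right[symmetric] inner_vec_def matrix_vector_mult_def by simp
  finally show ?thesis .
qed

text \<open>The relations that insert \<open>f\<close> into \<open>g h\<close> and \<open>h\<close>
  into \<open>g f\<close> have two of their three terms in common.\<close>

lemma trilin_reverse:
  "trilin C f g h - trilin C h g f = (f \<bullet> \<l>) * (g \<bullet> (S *v h)) - (h \<bullet> \<l>) * (g \<bullet> (S *v f))"
  using trilin_shuffle[of f g h] trilin_shuffle[of h g f] by linarith

text \<open>For equal arguments the shuffle relation counts the left hand side three times, and only
  the symmetric part of \<open>S\<close> contributes, which \<open>shuffle2\<close>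
  determines.\<close>

lemma trilin_cube: "trilin C f f f = (f \<bullet> \<l>) ^ 3 / 6"
proof -
  have "2 * (f \<bullet> (S *v f)) = (f \<bullet> \<l>)\<^sup>2"
  proof -
    have e: "f \<bullet> (S *v f) = (\<Sum>i\<in>UNIV. \<Sum>j\<in>UNIV. S $ i $ j * f $ i * f $ j)"
      unfolding inner_vec_def matrix_vector_mult_def
      by (simp add: sum_distrib_left algebra_simps)
    also have "\<dots> = (\<Sum>i\<in>UNIV. \<Sum>j\<in>UNIV. S $ j $ i * f $ i * f $ j)"
      by (subst sum.swap) (simp add: algebra_simps)
    finally have "2 * (f \<bullet> (S *v f)) = (\<Sum>i\<in>UNIV. \<Sum>j\<in>UNIV. (S $ i $ j + S $ j $ i) * f $ i * f $ j)"
      using e by (simp add: sum.distrib distrib_right)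
    also have "\<dots> = (\<Sum>i\<in>UNIV. f $ i * \<l> $ i * (\<Sum>j\<in>UNIV. f $ j * \<l> $ j))"
      unfolding shuffle2 sum_distrib_left by (intro sum.cong refl) (simp add: algebra_simps)
    also have "\<dots> = (f \<bullet> \<l>)\<^sup>2"
      unfolding sum_distrib_right[symmetric] inner_vec_def power2_eq_square by simp
    finally show ?thesis .
  qed
  moreover have "6 * trilin C f f f = (f \<bullet> \<l>) * (2 * (f \<bullet> (S *v f)))"
    using trilin_shuffle[of f f f] by simp
  ultimately show ?thesis
    by (simp add: power2_eq_square power3_eq_cube)
qed

text \<open>Up to a factor 6 the diagonal entries of the tensor are the cubes of the entries of
  \<open>\<l>\<close>, and cubing is injective on the reals.\<close>

lemma stabilizer_fixes_endpoint:
  assumes "tensor_act C A A A = C"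
  shows "A *v \<l> = \<l>"
proof -
  have "(A *v \<l>) $ i = \<l> $ i" for i
  proof -
    have "trilin C (A $ i) (A $ i) (A $ i) = C $ i $ i $ i"
      using assms by (metis tensor_act_nth)
    also have "\<dots> = trilin C (axis i 1) (axis i 1) (axis i 1)"
      by (simp add: trilin_axis)
    finally have "((A *v \<l>) $ i) ^ 3 = (\<l> $ i) ^ 3"
      unfolding trilin_cube by (simp add: matrix_vector_mul_component inner_axis')
    then show ?thesis
      by (metis odd_numeral odd_real_root_power_cancel)
  qed
  then show ?thesis by (simp add: vec_eq_iff)
qed

end

section \<open>Matrices fixing every term\<close>

text \<open>Each of the three involutions leaves one slot of an outer product in place: the middle,
  the left and the right one. The signs are those of a shuffle relation in which one term and the
  right hand side vanish.\<close>

definition reverse3 :: "real ^ 'm ^ 'm ^ 'm \<Rightarrow> real ^ 'm ^ 'm ^ 'm" where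
  "reverse3 T = (\<chi> i j k. T $ k $ j $ i)"

definition neg_swap_right :: "real ^ 'm ^ 'm ^ 'm \<Rightarrow> real ^ 'm ^ 'm ^ 'm" where
  "neg_swap_right T = (\<chi> i j k. - T $ i $ k $ j)"

definition neg_swap_left :: "real ^ 'm ^ 'm ^ 'm \<Rightarrow> real ^ 'm ^ 'm ^ 'm" where
  "neg_swap_left T = (\<chi> i j k. - T $ j $ i $ k)"

lemma slot_permutations_outer3:
  "reverse3 (outer3 u v w) = outer3 w v u"
  "neg_swap_right (outer3 u v w) = outer3 u w (- v)"
  "neg_swap_left (outer3 u v w) = outer3 (- v) u w"
  by (simp_all add: reverse3_def neg_swap_right_def neg_swap_left_def vec_eq_iff)

lemma slot_permutations_involutive:
  "reverse3 (reverse3 T) = T" "neg_swap_right (neg_swap_right T) = T" "neg_swap_left (neg_swap_left T) = T"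
  by (simp_all add: reverse3_def neg_swap_right_def neg_swap_left_def vec_eq_iff)

lemma slot_permutations_add:
  "reverse3 (T + T') = reverse3 T + reverse3 T'"
  "neg_swap_right (T + T') = neg_swap_right T + neg_swap_right T'"
  "neg_swap_left (T + T') = neg_swap_left T + neg_swap_left T'"
  by (simp_all add: reverse3_def neg_swap_right_def neg_swap_left_def vec_eq_iff)

lemma slot_permutations_rank_one:
  assumes "rank_one T"
  shows "rank_one (reverse3 T)" "rank_one (neg_swap_right T)" "rank_one (neg_swap_left T)"
  using assms unfolding rank_one_def[of T]
  by (auto simp: slot_permutations_outer3)

lemma sum_mset_if_filter:
  fixes f :: "'a \<Rightarrow> 'b :: comm_monoid_add"
  assumes "\<And>x. x \<in># D \<Longrightarrow> f x = (if P x then x' x else 0)"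
  shows "(\<Sum>x\<in>#D. f x) = (\<Sum>x\<in>#filter_mset P D. x' x)"
  using assms by (induction D) auto

lemma disjoint_filters_subset:
  assumes "\<And>x. x \<in># D \<Longrightarrow> \<not> (P x \<and> Q x)"
  shows "filter_mset P D + filter_mset Q D \<subseteq># D"
proof (rule mset_subset_eqI)
  fix x show "count (filter_mset P D + filter_mset Q D) x \<le> count D x"
    using assms[of x] by (cases "x \<in># D") (auto simp: not_in_iff)
qed

context signature_tensor
begin

text \<open>The factors of an outer product are unique up to scalars of product 1, so a matrix
  fixing it has them as eigenvectors.\<close>

lemma eigenvalues_of_term_fixing:
  assumes D: "D \<in> minimal_decompositions C"
    and G: "\<And>T. T \<in># D \<Longrightarrow> tensor_act T G G G = T"
  obtains u v w a b c where
    "\<And>T. T \<in># D \<Longrightarrow> T = outer3 (u T) (v T) (w T) \<and> u T \<noteq> 0 \<and> v T \<noteq> 0 \<and> w T \<noteq> 0 \<and>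
       G *v u T = a T *\<^sub>R u T \<and> G *v v T = b T *\<^sub>R v T \<and> G *v w T = c T *\<^sub>R w T \<and> a T * b T * c T = (1::real)"
proof -
  have "\<exists>u v w a b c. T = outer3 u v w \<and> u \<noteq> 0 \<and> v \<noteq> 0 \<and> w \<noteq> 0 \<and>
       G *v u = a *\<^sub>R u \<and> G *v v = b *\<^sub>R v \<and> G *v w = c *\<^sub>R w \<and> a * b * c = (1::real)" if "T \<in># D" for T
  proof -
    have "rank_one T" using D that by (auto simp: minimal_decompositions_def decomposition_def)
    then obtain u v w where T: "T = outer3 u v w" and nz: "u \<noteq> 0" "v \<noteq> 0" "w \<noteq> 0"
      unfolding rank_one_def by blast
    have "outer3 u v w = outer3 (G *v u) (G *v v) (G *v w)"
      using G[OF that] unfolding T tensor_act_outer3 by simp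
    from outer3_eqE[OF this nz] show ?thesis using T nz by metis
  qed
  then show thesis using that by metis
qed

text \<open>The terms are sorted into classes by their eigenvalues \<open>(x, y, z)\<close>, whose
  product is 1. The facts \<open>R1\<close> to \<open>R4\<close> show one kind of class after the
  other to be empty, until only the eigenvalues 1 and -1 remain.\<close>

lemma term_fixing_eigenvalues:
  assumes D: "D \<in> minimal_decompositions C"
    and G: "\<And>T. T \<in># D \<Longrightarrow> tensor_act T G G G = T"
    and T: "T \<in># D"
  shows "\<exists>u v w a b c. T = outer3 u v w \<and> u \<noteq> 0 \<and> v \<noteq> 0 \<and> w \<noteq> 0 \<and>
       G *v u = a *\<^sub>R u \<and> G *v v = b *\<^sub>R v \<and> G *v w = c *\<^sub>R w \<and>
       a \<in> {1, -1} \<and> b \<in> {1, -1} \<and> c \<in> {1, -1::real}"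
proof -
  obtain u v w a b c where ev: "\<And>T. T \<in># D \<Longrightarrow> T = outer3 (u T) (v T) (w T) \<and> u T \<noteq> 0 \<and> v T \<noteq> 0 \<and> w T \<noteq> 0 \<and>
       G *v u T = a T *\<^sub>R u T \<and> G *v v T = b T *\<^sub>R v T \<and> G *v w T = c T *\<^sub>R w T \<and> a T * b T * c T = (1::real)"
    by (rule eigenvalues_of_term_fixing[OF D G]) (blast+)
  \<comment> \<open>The eigenvalue 1 is included so that the projections can be evaluated at
    \<open>\<l>\<close>.\<close>
  define E where "E = {1} \<union> a ` set_mset D \<union> b ` set_mset D \<union> c ` set_mset D"
  have "finite E" unfolding E_def by simp
  from eigenspace_projection[OF this, of G] obtain P where
    P: "\<And>l c x. c \<in> E \<Longrightarrow> G *v x = c *\<^sub>R x \<Longrightarrow> P l *v x = (if c = l then x else 0)"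
    by metis
  have sumD: "sum_mset D = C" using D by (simp add: minimal_decompositions_def decomposition_def)
  have "tensor_act C G G G = (\<Sum>T\<in>#D. tensor_act T G G G)" by (simp flip: sumD add: tensor_act_sum_mset)
  also have "\<dots> = (\<Sum>T\<in>#D. T)" by (rule arg_cong[where f = sum_mset], rule image_mset_cong) (rule G)
  finally have "G *v \<l> = \<l>" by (intro stabilizer_fixes_endpoint) (simp add: sumD)
  \<comment> \<open>Hence a shuffle relation has right hand side 0 once the inserted letter belongs
    to an eigenvalue other than 1.\<close>
  then have Pl: "P x $ i \<bullet> \<l> = 0" if "x \<noteq> 1" for x i
    using P[of 1 \<l> x] that by (simp add: E_def vec_eq_iff matrix_vector_mul_component)
  define B where "B x y z = filter_mset (\<lambda>T. a T = x \<and> b T = y \<and> c T = z) D" for x y z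
  have Bsub: "B x y z \<subseteq># D" for x y z unfolding B_def by simp
  have Bprod: "x * y * z = 1" if "B x y z \<noteq> {#}" for x y z
    using that ev unfolding B_def by (auto simp: filter_mset_eq_conv)
  \<comment> \<open>Each class sums to the component of \<open>C\<close> cut out by the projections
    in the three slots, so relations for \<open>C\<close> become relations between classes.\<close>
  have Bsum: "sum_mset (B x y z) = tensor_act C (P x) (P y) (P z)" for x y z
  proof -
    have "tensor_act T (P x) (P y) (P z) = (if a T = x \<and> b T = y \<and> c T = z then T else 0)" if "T \<in># D" for T
    proof -
      note ev = ev[OF that]
      have "a T \<in> E" "b T \<in> E" "c T \<in> E" using that unfolding E_def by auto
      then have "P x *v u T = (if a T = x then u T else 0)" "P y *v v T = (if b T = y then v T else 0)"
          "P z *v w T = (if c T = z then w T else 0)"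
        using P ev by blast+
      then have "tensor_act (outer3 (u T) (v T) (w T)) (P x) (P y) (P z)
          = (if a T = x \<and> b T = y \<and> c T = z then outer3 (u T) (v T) (w T) else 0)"
        unfolding tensor_act_outer3 by (auto simp: outer3_eq_0_iff)
      then show ?thesis using ev by metis
    qed
    then show ?thesis
      unfolding sumD[symmetric] tensor_act_sum_mset B_def by (subst sum_mset_if_filter) auto
  qed
  have Bnth: "sum_mset (B x y z) $ i $ j $ k = trilin C (P x $ i) (P y $ j) (P z $ k)" for x y z i j k
    unfolding Bsum by (rule tensor_act_nth)
  have empty: "B x y z = {#}" if "\<And>i j k. sum_mset (B x y z) $ i $ j $ k = 0" for x y z
    using that by (intro minimal_decompositions_sum_eq_0[OF D Bsub] tensor_eqI) simp
  have outer: "\<exists>u v w. T = outer3 u v w" if "T \<in># B x y z" for T x y z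
    using ev that unfolding B_def by auto
  have disj: "B x y z + B x' y' z' \<subseteq># D" if "(x,y,z) \<noteq> (x',y',z')" for x y z x' y' z'
    unfolding B_def using that by (intro disjoint_filters_subset) auto
  \<comment> \<open>The right hand side of \<open>trilin_reverse\<close> vanishes, so the sums of
    the classes \<open>(x, y, z)\<close> and \<open>(z, y, x)\<close> are reversals of each other,
    and the exchange produces two terms with the same middle vector. The classes are disjoint
    because \<open>x \<noteq> z\<close>.\<close>
  have R1: "B x y z = {#}" if xz: "x \<noteq> 1" "z \<noteq> 1" "x \<noteq> z" for x y z
  proof (rule ccontr)
    assume "B x y z \<noteq> {#}"
    then obtain T where T: "T \<in># B x y z" by blast
    have sub: "B x y z + B z y x \<subseteq># D" using xz by (intro disj) auto
    have sw: "sum_mset (B z y x) = reverse3 (sum_mset (B x y z))"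
    proof (rule tensor_eqI)
      fix i j k
      show "sum_mset (B z y x) $ i $ j $ k = reverse3 (sum_mset (B x y z)) $ i $ j $ k"
        using trilin_reverse[of "P z $ i" "P y $ j" "P x $ k"] xz by (simp add: reverse3_def Bnth Pl)
    qed
    have "D - B z y x + image_mset reverse3 (B x y z) \<in> minimal_decompositions C"
      by (rule minimal_decompositions_swap[where \<phi> = reverse3, OF D sub sw])
        (simp_all add: slot_permutations_involutive slot_permutations_add slot_permutations_rank_one)
    then show False
      using minimal_decompositions_swap_pair[OF sub T, of reverse3] outer[OF T]
        no_shared_middle[OF finite_minimal_decompositions] slot_permutations_outer3(1) by metis
  qed
  \<comment> \<open>Inserting \<open>y\<close> into \<open>x x\<close>: two of the three classes are
    empty by \<open>R1\<close>, hence so is the third. Here \<open>y \<noteq> x\<close>, since 1 is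
    the only real cube root of 1.\<close>
  have R2: "B x y x = {#}" if x: "x \<noteq> 1" "x \<noteq> -1" for x y
  proof (rule ccontr)
    assume ne: "B x y x \<noteq> {#}"
    have p: "x * y * x = 1" by (rule Bprod[OF ne])
    then have "y \<noteq> 1" using x by (auto simp: square_eq_1_iff)
    moreover have "y \<noteq> x"
    proof
      assume "y = x"
      then have "x ^ 3 = 1 ^ 3" using p by (simp add: power3_eq_cube)
      then show False using x by (metis odd_numeral odd_real_root_power_cancel)
    qed
    ultimately have "B y x x = {#}" "B x x y = {#}" using R1 x by auto
    then have "trilin C (P y $ j) (P x $ i) (P x $ k) = 0" "trilin C (P x $ i) (P x $ k) (P y $ j) = 0" for i j k
      using Bnth[of y x x j i k] Bnth[of x x y i k j] by simp_all
    then have "B x y x = {#}"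
      using trilin_shuffle \<open>y \<noteq> 1\<close> by (intro empty) (metis Bnth Pl add.left_neutral add.right_neutral mult_zero_left)
    then show False using ne by simp
  qed
  have inverse: "y \<noteq> 1 \<and> y \<noteq> x" if "x * y = 1" "x \<noteq> 1" "x \<noteq> -1" for x y :: real
    using that by (auto simp: square_eq_1_iff)
  \<comment> \<open>Inserting \<open>x\<close> into \<open>1 y\<close>: the class
    \<open>(x, 1, y)\<close> is empty by \<open>R1\<close>, which leaves a signed exchange of the
    last two slots and a common left vector.\<close>
  have R3: "B 1 x y = {#}" if x: "x \<noteq> 1" "x \<noteq> -1" for x y
  proof (rule ccontr)
    assume ne: "B 1 x y \<noteq> {#}"
    then obtain T where T: "T \<in># B 1 x y" by blast
    have y: "y \<noteq> 1" "y \<noteq> x" using inverse[of x y] Bprod[OF ne] x by auto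
    have sub: "B 1 x y + B 1 y x \<subseteq># D" using y by (intro disj) auto
    have "B x 1 y = {#}" using R1 x y by auto
    then have z: "trilin C (P x $ i) (P 1 $ j) (P y $ k) = 0" for i j k using Bnth[of x 1 y i j k] by simp
    have sw: "sum_mset (B 1 y x) = neg_swap_right (sum_mset (B 1 x y))"
    proof (rule tensor_eqI)
      fix i j k
      show "sum_mset (B 1 y x) $ i $ j $ k = neg_swap_right (sum_mset (B 1 x y)) $ i $ j $ k"
        using trilin_shuffle[of "P x $ k" "P 1 $ i" "P y $ j"] x by (simp add: neg_swap_right_def Bnth Pl z)
    qed
    have "D - B 1 y x + image_mset neg_swap_right (B 1 x y) \<in> minimal_decompositions C"
      by (rule minimal_decompositions_swap[where \<phi> = neg_swap_right, OF D sub sw])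
        (simp_all add: slot_permutations_involutive slot_permutations_add slot_permutations_rank_one)
    then show False
      using minimal_decompositions_swap_pair[OF sub T, of neg_swap_right] outer[OF T]
        no_shared_left[OF finite_minimal_decompositions] slot_permutations_outer3(2) by metis
  qed
  \<comment> \<open>The mirror image of \<open>R3\<close>: a signed exchange of the first two slots
    and a common right vector.\<close>
  have R4: "B x y 1 = {#}" if x: "x \<noteq> 1" "x \<noteq> -1" for x y
  proof (rule ccontr)
    assume ne: "B x y 1 \<noteq> {#}"
    then obtain T where T: "T \<in># B x y 1" by blast
    have y: "y \<noteq> 1" "y \<noteq> x" using inverse[of x y] Bprod[OF ne] x by auto
    have sub: "B x y 1 + B y x 1 \<subseteq># D" using y by (intro disj) auto
    have "B y 1 x = {#}" using R1 x y by auto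
    then have z: "trilin C (P y $ i) (P 1 $ j) (P x $ k) = 0" for i j k using Bnth[of y 1 x i j k] by simp
    have sw: "sum_mset (B y x 1) = neg_swap_left (sum_mset (B x y 1))"
    proof (rule tensor_eqI)
      fix i j k
      show "sum_mset (B y x 1) $ i $ j $ k = neg_swap_left (sum_mset (B x y 1)) $ i $ j $ k"
        using trilin_shuffle[of "P x $ j" "P y $ i" "P 1 $ k"] x by (simp add: neg_swap_left_def Bnth Pl z)
    qed
    have "D - B y x 1 + image_mset neg_swap_left (B x y 1) \<in> minimal_decompositions C"
      by (rule minimal_decompositions_swap[where \<phi> = neg_swap_left, OF D sub sw])
        (simp_all add: slot_permutations_involutive slot_permutations_add slot_permutations_rank_one)
    then show False
      using minimal_decompositions_swap_pair[OF sub T, of neg_swap_left] outer[OF T]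
        no_shared_right[OF finite_minimal_decompositions] slot_permutations_outer3(3) by metis
  qed
  have ne: "B (a T) (b T) (c T) \<noteq> {#}" using T unfolding B_def by (auto simp: filter_mset_eq_conv)
  have p: "a T * b T * c T = 1" using ev[OF T] by simp
  have one: "y \<in> {1, -1}" if "x * y = 1" "x \<in> {1, -1}" for x y :: real using that by auto
  \<comment> \<open>If the first eigenvalue is 1, \<open>R3\<close> applies; otherwise
    \<open>R4\<close> if the third is 1. If neither is 1, they agree by \<open>R1\<close> and equal
    -1 by \<open>R2\<close>.\<close>
  have "a T \<in> {1, -1} \<and> b T \<in> {1, -1} \<and> c T \<in> {1, -1}"
  proof (cases "a T = 1")
    case True
    then have "b T \<in> {1, -1}" using R3[of "b T" "c T"] ne by auto
    then show ?thesis using p True one[of "b T" "c T"] by simp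
  next
    case False
    have "a T = -1"
    proof (cases "c T = 1")
      case True
      then show ?thesis using R4[of "a T" "b T"] ne False by auto
    next
      case c: False
      then have "a T = c T" using R1[of "a T" "c T" "b T"] ne False by auto
      then show ?thesis using R2[of "a T" "b T"] ne False by auto
    qed
    moreover have "c T \<in> {1, -1}"
    proof (cases "c T = 1")
      case c: False
      then have "a T = c T" using R1[of "a T" "c T" "b T"] ne False by blast
      then show ?thesis using calculation by simp
    qed simp
    ultimately show ?thesis using p one[of "a T * c T" "b T"] by (auto simp: algebra_simps)
  qed
  then show ?thesis using ev[OF T] by blast
qed

end

section \<open>Matrices permuting the terms\<close>

definition matrix_group :: "(real ^ 'm ^ 'm) set \<Rightarrow> bool" where
  "matrix_group \<Gamma> \<longleftrightarrow> mat 1 \<in> \<Gamma> \<and> (\<forall>A\<in>\<Gamma>. invertible A \<and> matrix_inv A \<in> \<Gamma>) \<and> (\<forall>A\<in>\<Gamma>. \<forall>B\<in>\<Gamma>. A ** B \<in> \<Gamma>)"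

lemma matrix_inv_mult:
  fixes A :: "real ^ 'm ^ 'm"
  assumes "invertible A"
  shows "matrix_inv A ** A = mat 1" "A ** matrix_inv A = mat 1"
proof -
  have "A ** matrix_inv A = mat 1 \<and> matrix_inv A ** A = mat 1"
    using assms unfolding invertible_def matrix_inv_def by (rule someI_ex)
  then show "matrix_inv A ** A = mat 1" "A ** matrix_inv A = mat 1" by simp_all
qed

lemma matrix_inv_mult_vec:
  fixes A :: "real ^ 'm ^ 'm"
  assumes "invertible A"
  shows "matrix_inv A *v (A *v x) = x" "A *v (matrix_inv A *v x) = x"
  by (simp_all add: matrix_vector_mul_assoc matrix_inv_mult assms)

lemma tensor_act_matrix_inv:
  fixes A :: "real ^ 'm ^ 'm"
  assumes "invertible A"
  shows "tensor_act (tensor_act T A A A) (matrix_inv A) (matrix_inv A) (matrix_inv A) = T"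
  by (simp add: tensor_act_tensor_act matrix_inv_mult assms)

lemma matrix_group_subset:
  assumes "matrix_group \<Gamma>" and "Q (mat 1)"
    and "\<And>A B. Q A \<Longrightarrow> Q B \<Longrightarrow> Q (A ** B)"
    and "\<And>A. invertible A \<Longrightarrow> Q A \<Longrightarrow> Q (matrix_inv A)"
  shows "matrix_group {A \<in> \<Gamma>. Q A}"
  using assms unfolding matrix_group_def by blast

text \<open>An orbit-stabilizer bound: multiplication by the inverse of one element of a fibre of
  \<open>f\<close> maps the fibre injectively into \<open>\<Gamma>'\<close>.\<close>

lemma matrix_group_card_le:
  fixes \<Gamma> :: "(real ^ 'm ^ 'm) set"
  assumes \<Gamma>: "matrix_group \<Gamma>" and Y: "finite Y" "f ` \<Gamma> \<subseteq> Y" and \<Gamma>': "finite \<Gamma>'"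
    and fib: "\<And>A B. A \<in> \<Gamma> \<Longrightarrow> B \<in> \<Gamma> \<Longrightarrow> f A = f B \<Longrightarrow> matrix_inv A ** B \<in> \<Gamma>'"
  shows "finite \<Gamma> \<and> card \<Gamma> \<le> card Y * card \<Gamma>'"
proof -
  have fiber: "finite {B \<in> \<Gamma>. f B = y} \<and> card {B \<in> \<Gamma>. f B = y} \<le> card \<Gamma>'" if y: "y \<in> f ` \<Gamma>" for y
  proof -
    obtain A where A: "A \<in> \<Gamma>" "f A = y" using y by blast
    have inv: "invertible A" using \<Gamma> A unfolding matrix_group_def by blast
    have inj: "inj_on (\<lambda>B. matrix_inv A ** B) {B \<in> \<Gamma>. f B = y}"
    proof (rule inj_onI)
      fix B B' assume "matrix_inv A ** B = matrix_inv A ** B'"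
      then have "A ** (matrix_inv A ** B) = A ** (matrix_inv A ** B')" by simp
      then show "B = B'" by (simp add: matrix_mul_assoc matrix_inv_mult inv)
    qed
    moreover have im: "(\<lambda>B. matrix_inv A ** B) ` {B \<in> \<Gamma>. f B = y} \<subseteq> \<Gamma>'"
      using fib A by auto
    ultimately show ?thesis
      using \<Gamma>' card_inj_on_le inj_on_finite by blast
  qed
  have un: "\<Gamma> = (\<Union>y\<in>f ` \<Gamma>. {B \<in> \<Gamma>. f B = y})" by blast
  have finf: "finite (f ` \<Gamma>)" using Y finite_subset by blast
  have "finite (\<Union>y\<in>f ` \<Gamma>. {B \<in> \<Gamma>. f B = y})"
    using finf fiber by (intro finite_UN_I) auto
  moreover have "card (\<Union>y\<in>f ` \<Gamma>. {B \<in> \<Gamma>. f B = y}) \<le> (\<Sum>y\<in>f ` \<Gamma>. card {B \<in> \<Gamma>. f B = y})"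
    by (rule card_UN_le[OF finf])
  moreover have "(\<Sum>y\<in>f ` \<Gamma>. card {B \<in> \<Gamma>. f B = y}) \<le> (\<Sum>y\<in>f ` \<Gamma>. card \<Gamma>')"
    by (rule sum_mono) (use fiber in auto)
  moreover have "(\<Sum>y\<in>f ` \<Gamma>. card \<Gamma>') \<le> card Y * card \<Gamma>'"
    using card_mono[OF Y] by simp
  ultimately show ?thesis using un by (metis (no_types, lifting) le_trans)
qed

definition fixed_space :: "(real ^ 'm ^ 'm) set \<Rightarrow> (real ^ 'm) set" where
  "fixed_space \<Gamma> = {x. \<forall>G\<in>\<Gamma>. G *v x = x}"

lemma subspace_fixed_space: "subspace (fixed_space \<Gamma>)"
  unfolding subspace_def fixed_space_def
  by (auto simp: matrix_vector_right_distrib matrix_vector_mult_scaleR)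

lemma dim_fixed_space_subset:
  assumes "x \<notin> fixed_space \<Gamma>" "\<Gamma>' \<subseteq> \<Gamma>" "\<And>G. G \<in> \<Gamma>' \<Longrightarrow> G *v x = x"
  shows "dim (fixed_space \<Gamma>) + 1 \<le> dim (fixed_space \<Gamma>')"
proof -
  have "insert x (fixed_space \<Gamma>) \<subseteq> fixed_space \<Gamma>'"
    using assms(2,3) unfolding fixed_space_def by auto
  then have "dim (insert x (fixed_space \<Gamma>)) \<le> dim (fixed_space \<Gamma>')" by (rule dim_subset)
  moreover have "x \<notin> span (fixed_space \<Gamma>)"
    using assms(1) subspace_fixed_space span_eq_iff by blast
  ultimately show ?thesis by (simp add: dim_insert)
qed

text \<open>Of the factors from \<open>q + 1\<close> to \<open>q + n + 1\<close>, all but the first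
  are at least 2. This pays for leftover powers of 2 once a group has shrunk to the
  identity.\<close>

lemma power_of_2_mult_fact_le: "2 ^ n * fact q \<le> (fact (q + n + 1) :: nat)"
proof (induction n)
  case 0
  show ?case by simp
next
  case (Suc n)
  have "2 ^ Suc n * fact q = 2 * (2 ^ n * fact q :: nat)" by simp
  also have "\<dots> \<le> (q + Suc n + 1) * fact (q + n + 1)"
    by (intro mult_mono Suc.IH) auto
  also have "\<dots> = fact (q + Suc n + 1)" by simp
  finally show ?case .
qed

definition matrix_pow :: "real ^ 'm ^ 'm \<Rightarrow> nat \<Rightarrow> real ^ 'm ^ 'm" where
  "matrix_pow G k = ((**) G ^^ k) (mat 1)"

lemma matrix_pow_simps [simp]: "matrix_pow G 0 = mat 1" "matrix_pow G (Suc k) = G ** matrix_pow G k"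
  by (simp_all add: matrix_pow_def)

lemma matrix_pow_eigenvector: "G *v x = c *\<^sub>R x \<Longrightarrow> matrix_pow G k *v x = c ^ k *\<^sub>R x"
  by (induction k) (simp_all add: matrix_vector_mul_assoc[symmetric] matrix_vector_mult_scaleR)

section \<open>The group permuting the terms of a minimal decomposition\<close>

locale minimal_signature_decomposition = signature_tensor C \<l> S
  for C :: "real ^ 'm ^ 'm ^ 'm" and \<l> S +
  fixes D :: "(real ^ 'm ^ 'm ^ 'm) multiset"
  assumes D: "D \<in> minimal_decompositions C"
begin

text \<open>The group H of the outline; \<open>term_permuting\<close> is N.\<close>

definition stabilizer :: "(real ^ 'm ^ 'm) set" where
  "stabilizer = {A. tensor_act C A A A = C}"

definition term_permuting :: "(real ^ 'm ^ 'm) set" where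
  "term_permuting = {A \<in> stabilizer. image_mset (\<lambda>T. tensor_act T A A A) D = D}"

lemma term_in_D:
  assumes "T \<in># D"
  obtains u v w where "T = outer3 u v w" "u \<noteq> 0" "v \<noteq> 0" "w \<noteq> 0"
  using D assms unfolding minimal_decompositions_def decomposition_def rank_one_def by blast

lemma sum_mset_D: "sum_mset D = C"
  using D unfolding minimal_decompositions_def decomposition_def by simp

lemma card_set_mset_D: "card (set_mset D) = tensor_rank C"
proof -
  have "count D T = count (mset_set (set_mset D)) T" for T
    using minimal_decompositions_count_le_1[OF finite_minimal_decompositions D, of T]
    by (cases "T \<in># D") (auto simp: not_in_iff count_mset_set' simp flip: count_greater_zero_iff)
  then have "D = mset_set (set_mset D)" by (rule multiset_eqI)
  then have "size D = card (set_mset D)" by (metis size_mset_set)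
  then show ?thesis using D unfolding minimal_decompositions_def by simp
qed

lemma pair_subset_D:
  assumes "T \<in># D" "T' \<in># D" "T \<noteq> T'"
  shows "{#T, T'#} \<subseteq># D"
  using assms by (auto simp: insert_subset_eq_iff in_diff_count)

text \<open>Otherwise \<open>C\<close> would lie in the cube of a proper subspace. In this form
  conciseness supplies a term with a vector outside a given proper subspace.\<close>

lemma vectors_span:
  assumes "subspace W" "\<And>T. T \<in># D \<Longrightarrow> \<exists>u v w. T = outer3 u v w \<and> u \<in> W \<and> v \<in> W \<and> w \<in> W"
  shows "W = UNIV"
  using sum_mset_in_tensor_cube[OF assms(2)] concise assms(1) sum_mset_D
  unfolding symmetrically_concise_def by metis

lemma stabilizer_invertible: "A \<in> stabilizer \<Longrightarrow> invertible A"
  using symmetrically_concise_invertible[OF concise] unfolding stabilizer_def by blast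

lemma matrix_group_stabilizer: "matrix_group stabilizer"
proof -
  have "tensor_act C (matrix_inv A) (matrix_inv A) (matrix_inv A) = C" if "tensor_act C A A A = C" "invertible A" for A
    using tensor_act_matrix_inv[OF that(2), of C] that(1) by simp
  moreover have "tensor_act C (A ** B) (A ** B) (A ** B) = C" if "tensor_act C A A A = C" "tensor_act C B B B = C" for A B
    using that tensor_act_tensor_act[of C B B B A A A] by simp
  ultimately show ?thesis
    using stabilizer_invertible unfolding matrix_group_def stabilizer_def by auto
qed

lemma matrix_group_term_permuting: "matrix_group term_permuting"
  unfolding term_permuting_def
proof (rule matrix_group_subset[OF matrix_group_stabilizer])
  fix A B :: "real ^ 'm ^ 'm"
  assume "image_mset (\<lambda>T. tensor_act T A A A) D = D" "image_mset (\<lambda>T. tensor_act T B B B) D = D"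
  then have "image_mset (\<lambda>T. tensor_act T A A A) (image_mset (\<lambda>T. tensor_act T B B B) D) = D" by simp
  then show "image_mset (\<lambda>T. tensor_act T (A ** B) (A ** B) (A ** B)) D = D"
    by (simp add: multiset.map_comp o_def tensor_act_tensor_act)
next
  fix A :: "real ^ 'm ^ 'm"
  let ?B = "matrix_inv A"
  assume A: "invertible A" "image_mset (\<lambda>T. tensor_act T A A A) D = D"
  have "image_mset (\<lambda>T. tensor_act T ?B ?B ?B) (image_mset (\<lambda>T. tensor_act T A A A) D) = D"
    by (simp add: multiset.map_comp o_def tensor_act_matrix_inv A(1))
  then show "image_mset (\<lambda>T. tensor_act T ?B ?B ?B) D = D" using A(2) by simp
qed simp

lemma term_permuting_term: "G \<in> term_permuting \<Longrightarrow> T \<in># D \<Longrightarrow> tensor_act T G G G \<in># D"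
  unfolding term_permuting_def by (metis (mono_tags, lifting) image_eqI mem_Collect_eq set_image_mset)

lemma term_permuting_invertible: "G \<in> term_permuting \<Longrightarrow> invertible G"
  using stabilizer_invertible unfolding term_permuting_def by blast

text \<open>The matrix induces a permutation of the finitely many terms, which has finite
  order.\<close>

lemma term_permuting_pow:
  assumes "G \<in> term_permuting"
  obtains k where "k > 0"
    "\<And>T. T \<in># D \<Longrightarrow> tensor_act T (matrix_pow G k) (matrix_pow G k) (matrix_pow G k) = T"
proof -
  \<comment> \<open>Extended by the identity outside \<open>D\<close>, to have a permutation of all
    tensors.\<close>
  define p where "p T = (if T \<in># D then tensor_act T G G G else T)" for T
  have "inj_on p (set_mset D)"
  proof (rule inj_onI)
    fix T T' assume "T \<in># D" "T' \<in># D" "p T = p T'"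
    then show "T = T'"
      using tensor_act_matrix_inv[OF term_permuting_invertible[OF assms]] unfolding p_def by metis
  qed
  moreover have "p ` set_mset D = set_mset D"
  proof -
    have "p ` set_mset D = set_mset (image_mset (\<lambda>T. tensor_act T G G G) D)"
      by (auto simp: p_def)
    moreover have "image_mset (\<lambda>T. tensor_act T G G G) D = D"
      using assms unfolding term_permuting_def by simp
    ultimately show ?thesis by (simp only:)
  qed
  ultimately have "p permutes set_mset D"
    by (intro bij_imp_permutes) (auto simp: bij_betw_def p_def)
  then have "permutation p" unfolding permutation_permutes by blast
  then obtain k where k: "p ^^ k = id" "k > 0" by (rule permutation_is_nilpotent)
  have "(p ^^ n) T = tensor_act T (matrix_pow G n) (matrix_pow G n) (matrix_pow G n) \<and> (p ^^ n) T \<in># D"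
    if "T \<in># D" for T n
  proof (induction n)
    case 0
    show ?case using that by simp
  next
    case (Suc n)
    then show ?case
      using term_permuting_term[OF assms] by (auto simp: p_def tensor_act_tensor_act[symmetric])
  qed
  from this[of _ k] show thesis using k by (intro that[of k]) simp_all
qed

text \<open>\<open>G\<close> may move other terms, but a power of it fixes them all and so has
  eigenvalues 1 and -1 on the factors. A real number with such a power is itself 1 or -1.\<close>

lemma fixed_term_signs:
  assumes G: "G \<in> term_permuting" and T: "outer3 u v w \<in># D" and fx: "tensor_act (outer3 u v w) G G G = outer3 u v w"
  obtains a b c :: real where "G *v u = a *\<^sub>R u" "G *v v = b *\<^sub>R v" "G *v w = c *\<^sub>R w"
    "a \<in> {1, -1}" "b \<in> {1, -1}" "c \<in> {1, -1}" "a * b * c = 1"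
proof -
  have nz: "u \<noteq> 0" "v \<noteq> 0" "w \<noteq> 0"
    using T D unfolding minimal_decompositions_def decomposition_def by auto
  have "outer3 u v w = outer3 (G *v u) (G *v v) (G *v w)"
    using fx unfolding tensor_act_outer3 by simp
  from outer3_eqE[OF this nz] obtain a b c where
    abc: "G *v u = a *\<^sub>R u" "G *v v = b *\<^sub>R v" "G *v w = c *\<^sub>R w" "a * b * c = 1" .
  obtain k where k: "k > 0"
    "\<And>T. T \<in># D \<Longrightarrow> tensor_act T (matrix_pow G k) (matrix_pow G k) (matrix_pow G k) = T"
    using term_permuting_pow[OF G] by blast
  let ?M = "matrix_pow G k"
  obtain u' v' w' a' b' c' where *: "outer3 u v w = outer3 u' v' w'"
     "?M *v u' = a' *\<^sub>R u'" "?M *v v' = b' *\<^sub>R v'" "?M *v w' = c' *\<^sub>R w'"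
     "a' \<in> {1, -1}" "b' \<in> {1, -1}" "c' \<in> {1, -1::real}"
    using term_fixing_eigenvalues[OF D k(2) T] by metis
  from outer3_eqE[OF *(1) nz] obtain x y z where
    xyz: "u' = x *\<^sub>R u" "v' = y *\<^sub>R v" "w' = z *\<^sub>R w" "x * y * z = 1" .
  have unit: "e \<in> {1, -1}" if "s = t *\<^sub>R r" "t \<noteq> 0" "r \<noteq> 0" "?M *v s = e' *\<^sub>R s" "e' \<in> {1, -1}" "G *v r = e *\<^sub>R r"
    for e e' t :: real and r s :: "real ^ 'm"
  proof -
    have "t *\<^sub>R (e ^ k *\<^sub>R r) = t *\<^sub>R (e' *\<^sub>R r)"
      using that(1,4) matrix_pow_eigenvector[OF that(6), of k]
      by (simp add: matrix_vector_mult_scaleR algebra_simps)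
    then have "e ^ k = e'" using that(2,3) by simp
    then have "\<bar>e\<bar> ^ k = 1 ^ k" using that(5) by (auto simp flip: power_abs)
    then have "\<bar>e\<bar> = 1" using k(1) power_eq_iff_eq_base[of k "\<bar>e\<bar>" 1] by simp
    then show ?thesis by auto
  qed
  have "x \<noteq> 0" "y \<noteq> 0" "z \<noteq> 0" using xyz(4) by auto
  then show thesis
    using that abc unit[OF xyz(1) _ nz(1) *(2,5) abc(1)] unit[OF xyz(2) _ nz(2) *(3,6) abc(2)]
      unit[OF xyz(3) _ nz(3) *(4,7) abc(3)] by blast
qed

text \<open>The image is again a term of \<open>D\<close>; if it were a different one, the two would
  share a vector.\<close>

lemma fixed_vector_imp_fixed_term:
  assumes G: "G \<in> term_permuting" and T: "outer3 u v w \<in># D"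
    and "G *v u = u \<or> G *v v = v \<or> G *v w = w"
  shows "tensor_act (outer3 u v w) G G G = outer3 u v w"
proof (rule ccontr)
  assume ne: "tensor_act (outer3 u v w) G G G \<noteq> outer3 u v w"
  have sub: "{#outer3 u v w, outer3 (G *v u) (G *v v) (G *v w)#} \<subseteq># D"
    using pair_subset_D[OF T term_permuting_term[OF G T]] ne by (simp add: tensor_act_outer3)
  from assms(3) show False
  proof (elim disjE)
    assume "G *v u = u"
    then show False using no_shared_left[OF finite_minimal_decompositions D] sub by metis
  next
    assume "G *v v = v"
    then show False using no_shared_middle[OF finite_minimal_decompositions D] sub by metis
  next
    assume "G *v w = w"
    then show False using no_shared_right[OF finite_minimal_decompositions D] sub by metis
  qed
qed

end

section \<open>The rank is at least the dimension\<close>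

context minimal_signature_decomposition
begin

text \<open>If the first factors of the terms do not span the space, some functional \<open>f\<close> kills the first
  slot of the tensor. The shuffle relations then make all transvections along \<open>f\<close> in the direction
  \<open>S(f, \<cdot>)\<close> stabilize the tensor. Infinitely many of these permute the terms of \<open>D\<close>, but none of them
  has finite order.\<close>

lemma trilin_eq_0_left:
  assumes "\<And>T. T \<in># D \<Longrightarrow> \<exists>u v w. T = outer3 u v w \<and> f \<bullet> u = 0"
  shows "trilin C f g h = 0"
proof -
  have "trilin (sum_mset M) f g h = 0" if "M \<subseteq># D" for M
    using that
  proof (induction M)
    case empty
    then show ?case by (simp add: trilin_def)
  next
    case (add T M)
    then have "T \<in># D" "M \<subseteq># D" by (auto dest: mset_subset_eq_insertD subset_mset.less_imp_le)
    then show ?case using add.IH assms[of T] by (auto simp: trilin_add_tensor trilin_outer3)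
  qed
  from this[of D] show ?thesis by (simp add: sum_mset_D)
qed

lemma CARD_le_tensor_rank: "CARD('m) \<le> tensor_rank C"
proof (rule ccontr)
  assume "\<not> CARD('m) \<le> tensor_rank C"
  then have less: "tensor_rank C < CARD('m)" by simp
  have "\<forall>T\<in>set_mset D. \<exists>u v w. T = outer3 u v w" using term_in_D by metis
  then obtain u v w where T: "\<And>T. T \<in># D \<Longrightarrow> T = outer3 (u T) (v T) (w T)" by metis
  have "dim (u ` set_mset D) \<le> card (u ` set_mset D)" by (rule dim_le_card') simp
  also have "\<dots> \<le> tensor_rank C" using card_image_le[of "set_mset D" u] card_set_mset_D by simp
  finally have "dim (u ` set_mset D) < DIM(real ^ 'm)" using less by simp
  then obtain f where f: "f \<noteq> 0" "\<And>y. y \<in> span (u ` set_mset D) \<Longrightarrow> orthogonal f y"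
    by (rule orthogonal_to_subspace_exists) blast
  have "f \<bullet> u T = 0" if "T \<in># D" for T
    using f(2)[of "u T"] that by (simp add: span_base orthogonal_def)
  then have left: "trilin C f g h = 0" for g h
    using T by (intro trilin_eq_0_left) metis
  have fl: "f \<bullet> \<l> = 0"
    using trilin_cube[of f] left by simp
  define s where "s = transpose S *v f"
  have fS: "f \<bullet> (S *v h) = s \<bullet> h" for h
    unfolding s_def by (metis dot_lmul_matrix vector_transpose_matrix inner_commute transpose_matrix_vector)
  \<comment> \<open>Inserting \<open>g\<close> into \<open>f h\<close> leaves one term only.
    Inserting \<open>f\<close> into \<open>g h\<close> then determines the values with
    \<open>f\<close> in the last slot.\<close>
  have middle: "trilin C g f h = (g \<bullet> \<l>) * (s \<bullet> h)" for g h
    using trilin_shuffle[of g f h] left fS by simp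
  have right: "trilin C g h f = - ((g \<bullet> \<l>) * (s \<bullet> h))" for g h
    using trilin_shuffle[of f g h] middle[of g h] left fl by simp
  \<comment> \<open>The two formulas give \<open>trilin C \<l> f f\<close> with opposite signs, and
    \<open>\<l>\<close> is non-zero.\<close>
  have sf: "s \<bullet> f = 0"
  proof -
    have "(\<l> \<bullet> \<l>) * (s \<bullet> f) = 0" using middle[of \<l> f] right[of \<l> f] by simp
    then show ?thesis using not_loop by simp
  qed
  have "s \<noteq> 0"
  proof
    assume "s = 0"
    then have "f = 0" using left middle right by (intro symmetrically_concise_functional[OF concise]) simp_all
    then show False using f(1) by simp
  qed
  \<comment> \<open>The transvections. Their first order effects on the middle and the right slot
    cancel, and the remaining ones vanish since \<open>f\<close> kills the left slot and is
    orthogonal to \<open>s\<close>.\<close>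
  define G :: "real \<Rightarrow> real ^ 'm ^ 'm" where "G c = (\<chi> i. axis i 1 + (c * s $ i) *\<^sub>R f)" for c
  have Gv: "G c *v x = x + (c * (f \<bullet> x)) *\<^sub>R s" for c x
    by (simp add: vec_eq_iff matrix_vector_mul_component G_def inner_add_left inner_axis' algebra_simps)
  have Gstab: "G c \<in> stabilizer" for c
    unfolding stabilizer_def mem_Collect_eq
  proof (rule tensor_eqI)
    fix i j k
    show "tensor_act C (G c) (G c) (G c) $ i $ j $ k = C $ i $ j $ k"
      unfolding tensor_act_nth G_def
      by (simp add: trilin_simps trilin_axis left middle right inner_add_right sf inner_axis inner_axis' algebra_simps)
  qed
  have Gadd: "G c ** G d = G (c + d)" for c d
    by (simp add: matrix_eq Gv matrix_vector_mul_assoc[symmetric] inner_add_right sf inner_commute[of f s] algebra_simps)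
  let ?im = "\<lambda>A. image_mset (\<lambda>T. tensor_act T A A A) D"
  \<comment> \<open>Infinitely many parameters meet finitely many minimal decompositions.\<close>
  have "\<exists>c d. c \<noteq> d \<and> ?im (G c) = ?im (G d)"
  proof (rule ccontr)
    assume "\<not> ?thesis"
    then have "inj (\<lambda>c. ?im (G c))" unfolding inj_def by blast
    moreover have "?im (G c) \<in> minimal_decompositions C" for c
      using image_mset_minimal_decompositions[OF D stabilizer_invertible] Gstab[of c] unfolding stabilizer_def by blast
    then have "finite (range (\<lambda>c. ?im (G c)))"
      using finite_minimal_decompositions by (meson finite_subset image_subsetI)
    ultimately show False using finite_imageD infinite_UNIV_char_0 by blast
  qed
  then obtain c d where cd: "c \<noteq> d" "?im (G c) = ?im (G d)" by blast
  define e where "e = d - c"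
  have comp: "image_mset (\<lambda>T. tensor_act T A A A) (?im B) = ?im (A ** B)" for A B
    by (simp add: multiset.map_comp o_def tensor_act_tensor_act)
  have "image_mset (\<lambda>T. tensor_act T (G (- c)) (G (- c)) (G (- c))) (?im (G c))
      = image_mset (\<lambda>T. tensor_act T (G (- c)) (G (- c)) (G (- c))) (?im (G d))"
    using cd(2) by simp
  then have "?im (G 0) = ?im (G e)" unfolding comp Gadd e_def by simp
  moreover have "G 0 = mat 1" by (simp add: matrix_eq Gv)
  ultimately have Ge: "G e \<in> term_permuting" using Gstab unfolding term_permuting_def by simp
  obtain k where k: "k > 0"
    "\<And>T. T \<in># D \<Longrightarrow> tensor_act T (matrix_pow (G e) k) (matrix_pow (G e) k) (matrix_pow (G e) k) = T"
    using term_permuting_pow[OF Ge] by blast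
  have pow: "matrix_pow (G e) n *v x = x + (real n * e * (f \<bullet> x)) *\<^sub>R s" for n x
    by (induction n) (simp_all add: Gv matrix_vector_mul_assoc[symmetric] inner_add_right sf inner_commute[of f s] algebra_simps)
  \<comment> \<open>The power is a transvection with non-zero parameter: off the kernel of
    \<open>f\<close> an eigenvalue would have to be 1, but no vector is fixed there.\<close>
  have eigen: "f \<bullet> x = 0" if "matrix_pow (G e) k *v x = a *\<^sub>R x" "a \<in> {1, -1}" for a x
  proof -
    have eq: "x + (real k * e * (f \<bullet> x)) *\<^sub>R s = a *\<^sub>R x" using that(1) by (simp add: pow)
    then have "f \<bullet> (x + (real k * e * (f \<bullet> x)) *\<^sub>R s) = f \<bullet> (a *\<^sub>R x)" by simp
    then have fx: "f \<bullet> x = a * (f \<bullet> x)" by (simp add: inner_add_right sf inner_commute[of f s])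
    show ?thesis
    proof (rule ccontr)
      assume "f \<bullet> x \<noteq> 0"
      then have "a = 1" using fx by simp
      then have "(real k * e * (f \<bullet> x)) *\<^sub>R s = 0" using eq by simp
      then show False using k(1) cd(1) \<open>f \<bullet> x \<noteq> 0\<close> \<open>s \<noteq> 0\<close> by (simp add: e_def)
    qed
  qed
  have "{x. f \<bullet> x = 0} = UNIV"
  proof (rule vectors_span)
    show "subspace {x. f \<bullet> x = 0}" by (rule subspace_hyperplane)
    fix T assume "T \<in># D"
    from term_fixing_eigenvalues[OF D k(2) this] obtain u v w a b c where "T = outer3 u v w"
      "matrix_pow (G e) k *v u = a *\<^sub>R u" "matrix_pow (G e) k *v v = b *\<^sub>R v" "matrix_pow (G e) k *v w = c *\<^sub>R w"
      "a \<in> {1, -1}" "b \<in> {1, -1}" "c \<in> {1, -1::real}" by metis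
    then show "\<exists>u v w. T = outer3 u v w \<and> u \<in> {x. f \<bullet> x = 0} \<and> v \<in> {x. f \<bullet> x = 0} \<and> w \<in> {x. f \<bullet> x = 0}"
      using eigen by blast
  qed
  then have "f \<bullet> f = 0" by blast
  then show False using f(1) by simp
qed

end

section \<open>The order of the stabilizer\<close>

context minimal_signature_decomposition
begin

text \<open>The invariant of the induction: every basis vector of the fixed space beyond those paid for by
  the terms in \<open>M\<close> (and beyond the end point of the path) accounts for a factor 2.\<close>

lemma card_fixing_subgroup_le:
  assumes "matrix_group \<Gamma>" and "\<Gamma> \<subseteq> term_permuting"
    and "M \<subseteq> set_mset D" and "\<And>T G. T \<in> M \<Longrightarrow> G \<in> \<Gamma> \<Longrightarrow> tensor_act T G G G = T"
    and "card M + 1 \<le> dim (fixed_space \<Gamma>)"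
    and rank: "CARD('m) \<le> tensor_rank C"
  shows "finite \<Gamma> \<and> card \<Gamma> * 2 ^ (dim (fixed_space \<Gamma>) - 1 - card M) * fact (tensor_rank C - CARD('m))
    \<le> (fact (tensor_rank C - card M) :: nat)"
  using assms(1-5)
proof (induction "CARD('m) - dim (fixed_space \<Gamma>)" arbitrary: \<Gamma> M rule: less_induct)
  case less
  let ?r = "tensor_rank C" and ?F = "fixed_space \<Gamma>" and ?a = "card M"
  note \<Gamma> = less.prems(1) and perm = subsetD[OF less.prems(2)] and M = less.prems(3,4) and slack = less.prems(5)
  have finM: "finite M" using M(1) finite_subset by blast
  have dim_le: "dim W \<le> CARD('m)" for W :: "(real ^ 'm) set"
    using dim_subset_UNIV[of W] by simp
  show ?case
  proof (cases "?F = UNIV")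
    case True
    then have "G = mat 1" if "G \<in> \<Gamma>" for G
      using that unfolding fixed_space_def by (auto simp: matrix_eq)
    moreover have "mat 1 \<in> \<Gamma>" using \<Gamma> unfolding matrix_group_def by blast
    ultimately have "\<Gamma> = {mat 1}" by blast
    \<comment> \<open>Only the identity is left; the surplus powers of 2 are paid by factors of the
      factorial that no orbit has used.\<close>
    moreover have "2 ^ (CARD('m) - 1 - ?a) * fact (?r - CARD('m)) \<le> (fact (?r - ?a) :: nat)"
    proof -
      have eq: "?r - CARD('m) + (CARD('m) - 1 - ?a) + 1 = ?r - ?a"
        using slack dim_le[of ?F] rank by linarith
      show ?thesis
        using power_of_2_mult_fact_le[of "CARD('m) - 1 - ?a" "?r - CARD('m)"] unfolding eq .
    qed
    ultimately show ?thesis using True by (simp add: dim_UNIV)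
  next
    case False
    \<comment> \<open>Passing to a subgroup costs a factor \<open>c\<close>. The last assumption
      says that the growth of the fixed space and of the set of fixed terms pays for it.\<close>
    have step: "finite \<Gamma> \<and> card \<Gamma> * 2 ^ (dim ?F - 1 - ?a) * fact (?r - CARD('m)) \<le> (fact (?r - ?a) :: nat)"
      if "finite \<Gamma>' \<Longrightarrow> finite \<Gamma> \<and> card \<Gamma> \<le> c * card \<Gamma>'"
        and "matrix_group \<Gamma>'" "\<Gamma>' \<subseteq> \<Gamma>" "M' \<subseteq> set_mset D" "\<And>T G. T \<in> M' \<Longrightarrow> G \<in> \<Gamma>' \<Longrightarrow> tensor_act T G G G = T"
        and "dim ?F < dim (fixed_space \<Gamma>')" "card M' + 1 \<le> dim (fixed_space \<Gamma>')"
        and "c * 2 ^ (dim ?F - 1 - ?a) * fact (?r - card M') \<le>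
           2 ^ (dim (fixed_space \<Gamma>') - 1 - card M') * (fact (?r - ?a) :: nat)"
      for \<Gamma>' M' c
    proof -
      let ?d = "dim (fixed_space \<Gamma>') - 1 - card M'"
      have "CARD('m) - dim (fixed_space \<Gamma>') < CARD('m) - dim ?F"
        using that(6) dim_le[of "fixed_space \<Gamma>'"] by linarith
      then have IH: "finite \<Gamma>'" "card \<Gamma>' * 2 ^ ?d * fact (?r - CARD('m)) \<le> (fact (?r - card M') :: nat)"
        using less.hyps[of \<Gamma>' M'] that(2-5,7) less.prems(2) by blast+
      have "card \<Gamma> * 2 ^ (dim ?F - 1 - ?a) * fact (?r - CARD('m)) * 2 ^ ?d
        \<le> (c * card \<Gamma>') * 2 ^ (dim ?F - 1 - ?a) * fact (?r - CARD('m)) * 2 ^ ?d"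
        using that(1)[OF IH(1)] by (intro mult_right_mono) auto
      also have "\<dots> = c * 2 ^ (dim ?F - 1 - ?a) * (card \<Gamma>' * 2 ^ ?d * fact (?r - CARD('m)))"
        by (simp add: algebra_simps)
      also have "\<dots> \<le> c * 2 ^ (dim ?F - 1 - ?a) * fact (?r - card M')"
        by (intro mult_left_mono IH(2)) auto
      also have "\<dots> \<le> fact (?r - ?a) * 2 ^ ?d" using that(8) by (simp add: algebra_simps)
      finally have "card \<Gamma> * 2 ^ (dim ?F - 1 - ?a) * fact (?r - CARD('m)) \<le> (fact (?r - ?a) :: nat)"
        by simp
      then show ?thesis using that(1)[OF IH(1)] by blast
    qed
    obtain T where T: "T \<in># D" "\<And>u v w. T = outer3 u v w \<Longrightarrow> u \<notin> ?F \<or> v \<notin> ?F \<or> w \<notin> ?F"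
      using vectors_span[OF subspace_fixed_space] False by blast
    obtain u v w where uvw: "T = outer3 u v w" "u \<noteq> 0" "v \<noteq> 0" "w \<noteq> 0" using term_in_D[OF T(1)] .
    have sub_group: "matrix_group {G \<in> \<Gamma>. G *v x = x}" for x
      by (rule matrix_group_subset[OF \<Gamma>]) (simp_all add: matrix_vector_mul_assoc[symmetric], metis matrix_inv_mult_vec(1))
    have inv_group: "matrix_inv A ** B \<in> \<Gamma>" "invertible A" if "A \<in> \<Gamma>" "B \<in> \<Gamma>" for A B
      using \<Gamma> that unfolding matrix_group_def by blast+
    show ?thesis
    proof (cases "\<forall>G\<in>\<Gamma>. tensor_act T G G G = T")
      case True
      \<comment> \<open>The term is fixed, but not every vector of it: fixing \<open>x\<close> costs
        a factor 2 and gains a dimension.\<close>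
      obtain x where x: "x \<in> {u, v, w}" "x \<notin> ?F" using T(2)[OF uvw(1)] by blast
      have sign: "G *v x \<in> {x, - x}" if "G \<in> \<Gamma>" for G
        using fixed_term_signs[of G u v w] perm[OF that] T(1) True that x(1) unfolding uvw(1)
        by (smt (verit) insertE insertI1 insertI2 scaleR_minus_left scaleR_one singletonD)
      let ?\<Gamma>' = "{G \<in> \<Gamma>. G *v x = x}"
      have dim: "dim ?F + 1 \<le> dim (fixed_space ?\<Gamma>')"
        by (rule dim_fixed_space_subset[OF x(2)]) auto
      show ?thesis
      proof (rule step[of ?\<Gamma>' 2 M])
        assume fin: "finite ?\<Gamma>'"
        have "finite \<Gamma> \<and> card \<Gamma> \<le> card {x, - x} * card ?\<Gamma>'"
        proof (rule matrix_group_card_le[OF \<Gamma> _ _ fin, where f = "\<lambda>G. G *v x"])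
          show "(\<lambda>G. G *v x) ` \<Gamma> \<subseteq> {x, - x}" using sign by auto
          fix A B assume AB: "A \<in> \<Gamma>" "B \<in> \<Gamma>" "A *v x = B *v x"
          then show "matrix_inv A ** B \<in> ?\<Gamma>'"
            using inv_group[OF AB(1,2)] matrix_inv_mult_vec(1)[of A x]
            by (simp add: matrix_vector_mul_assoc[symmetric])
        qed simp
        moreover have "card {x, - x} * card ?\<Gamma>' \<le> 2 * card ?\<Gamma>'"
          by (intro mult_right_mono) (simp_all add: card_insert_if)
        ultimately show "finite \<Gamma> \<and> card \<Gamma> \<le> 2 * card ?\<Gamma>'" by linarith
      next
        have "2 * 2 ^ (dim ?F - 1 - ?a) \<le> (2 :: nat) ^ (dim (fixed_space ?\<Gamma>') - 1 - ?a)"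
          unfolding power_Suc[symmetric] using dim slack by (intro power_increasing) auto
        then show "2 * 2 ^ (dim ?F - 1 - ?a) * fact (?r - ?a)
          \<le> 2 ^ (dim (fixed_space ?\<Gamma>') - 1 - ?a) * (fact (?r - ?a) :: nat)"
          by (rule mult_right_mono) simp
      qed (use sub_group M dim slack in auto)
    next
      case moved: False
      let ?\<Gamma>' = "{G \<in> \<Gamma>. tensor_act T G G G = T}"
      have T_notin: "T \<notin> M" using moved M(2) by blast
      have not_fixed: "u \<notin> ?F" "v \<notin> ?F" "w \<notin> ?F"
      proof -
        obtain G where G: "G \<in> \<Gamma>" "tensor_act T G G G \<noteq> T" using moved by blast
        then have "\<not> (G *v u = u \<or> G *v v = v \<or> G *v w = w)"
          using fixed_vector_imp_fixed_term[OF perm[OF G(1)], of u v w] T(1) uvw(1) by blast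
        then show "u \<notin> ?F" "v \<notin> ?F" "w \<notin> ?F" using G(1) unfolding fixed_space_def by auto
      qed
      have group': "matrix_group ?\<Gamma>'"
      proof (rule matrix_group_subset[OF \<Gamma>])
        fix A B :: "real ^ 'm ^ 'm"
        assume "tensor_act T A A A = T" "tensor_act T B B B = T"
        then show "tensor_act T (A ** B) (A ** B) (A ** B) = T"
          using tensor_act_tensor_act[of T B B B A A A] by simp
      next
        fix A :: "real ^ 'm ^ 'm" assume "invertible A" "tensor_act T A A A = T"
        then show "tensor_act T (matrix_inv A) (matrix_inv A) (matrix_inv A) = T"
          using tensor_act_matrix_inv[of A T] by simp
      qed simp
      \<comment> \<open>The terms in \<open>M\<close> are fixed by the whole group, so the orbit of
        \<open>T\<close> avoids them.\<close>
      have card': "finite \<Gamma> \<and> card \<Gamma> \<le> (?r - ?a) * card ?\<Gamma>'" if fin: "finite ?\<Gamma>'"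
      proof -
        have "finite \<Gamma> \<and> card \<Gamma> \<le> card (set_mset D - M) * card ?\<Gamma>'"
        proof (rule matrix_group_card_le[OF \<Gamma> _ _ fin, where f = "\<lambda>G. tensor_act T G G G"])
          show "(\<lambda>G. tensor_act T G G G) ` \<Gamma> \<subseteq> set_mset D - M"
          proof safe
            fix G assume G: "G \<in> \<Gamma>"
            then show "tensor_act T G G G \<in># D" using term_permuting_term perm T(1) by blast
            assume "tensor_act T G G G \<in> M"
            moreover have "matrix_inv G \<in> \<Gamma>" "invertible G" using \<Gamma> G unfolding matrix_group_def by blast+
            ultimately have "tensor_act T G G G = T"
              using M(2)[of "tensor_act T G G G" "matrix_inv G"] tensor_act_matrix_inv[of G T] by simp
            then show False using T_notin \<open>tensor_act T G G G \<in> M\<close> by simp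
          qed
          fix A B assume AB: "A \<in> \<Gamma>" "B \<in> \<Gamma>" "tensor_act T A A A = tensor_act T B B B"
          then show "matrix_inv A ** B \<in> ?\<Gamma>'"
            using inv_group[OF AB(1,2)] tensor_act_matrix_inv[of A T]
            by (simp add: tensor_act_tensor_act[symmetric])
        qed simp
        moreover have "card (set_mset D - M) = ?r - ?a"
          using card_set_mset_D M(1) finM by (simp add: card_Diff_subset)
        ultimately show ?thesis by simp
      qed
      have a_less: "?a < ?r"
      proof -
        have "card (insert T M) \<le> card (set_mset D)" using M(1) T(1) by (intro card_mono) auto
        then show ?thesis using T_notin finM card_set_mset_D by simp
      qed
      have cardM': "card (insert T M) = ?a + 1" using T_notin finM by simp
      have fact_rec: "(?r - ?a) * fact (?r - (?a + 1)) = (fact (?r - ?a) :: nat)"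
        using a_less by (metis Suc_eq_plus1 fact_Suc Suc_diff_Suc of_nat_id)
      show ?thesis
      proof (cases "\<exists>x\<in>{u, v, w}. \<forall>G\<in>?\<Gamma>'. G *v x = x")
        case True
        \<comment> \<open>\<open>T\<close> joins \<open>M\<close>, and \<open>?r - ?a\<close> is the
          next factor of the factorial. The new dimension offsets the new element of
          \<open>M\<close>, so the exponent of 2 does not drop.\<close>
        then obtain x where x: "x \<in> {u, v, w}" "\<And>G. G \<in> ?\<Gamma>' \<Longrightarrow> G *v x = x" by blast
        have dim: "dim ?F + 1 \<le> dim (fixed_space ?\<Gamma>')"
          by (rule dim_fixed_space_subset[of x]) (use x not_fixed in auto)
        show ?thesis
        proof (rule step[of ?\<Gamma>' "?r - ?a" "insert T M"])
          have le: "2 ^ (dim ?F - 1 - ?a) \<le> (2 :: nat) ^ (dim (fixed_space ?\<Gamma>') - 1 - (?a + 1))"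
            using dim by (intro power_increasing) auto
          show "(?r - ?a) * 2 ^ (dim ?F - 1 - ?a) * fact (?r - card (insert T M))
            \<le> 2 ^ (dim (fixed_space ?\<Gamma>') - 1 - card (insert T M)) * (fact (?r - ?a) :: nat)"
            unfolding cardM' fact_rec[symmetric]
            using mult_le_mono2[OF le, of "(?r - ?a) * fact (?r - (?a + 1))"] by (simp only: mult_ac)
        qed (use card' group' M T(1) dim slack cardM' in auto)
      next
        case False
        \<comment> \<open>The stabilizer of \<open>T\<close> fixes none of its vectors, so the fixed
          space need not have grown. It acts on \<open>u\<close>, \<open>v\<close>, \<open>w\<close>
          by signs of product 1: fixing \<open>u\<close> and \<open>v\<close> costs a factor 4 and
          fixes \<open>w\<close> too. This gains three dimensions, one to offset \<open>T\<close>
          and two for the factor 4.\<close>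
        let ?\<Gamma>2 = "{G \<in> ?\<Gamma>'. G *v u = u}" and ?\<Gamma>3 = "{G \<in> {G \<in> ?\<Gamma>'. G *v u = u}. G *v v = v}"
        have signs: "\<exists>a b c. G *v u = a *\<^sub>R u \<and> G *v v = b *\<^sub>R v \<and> G *v w = c *\<^sub>R w \<and>
            (a, b, c) \<in> {(1, 1, 1), (1, -1, -1), (-1, 1, -1), (-1, -1, 1::real)}" if "G \<in> ?\<Gamma>'" for G
        proof -
          have G: "G \<in> term_permuting" "tensor_act (outer3 u v w) G G G = outer3 u v w" "outer3 u v w \<in># D"
            using that perm uvw(1) T(1) by auto
          from fixed_term_signs[OF G(1,3,2)] obtain a b c :: real where
            *: "G *v u = a *\<^sub>R u" "G *v v = b *\<^sub>R v" "G *v w = c *\<^sub>R w"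
              "a \<in> {1, -1}" "b \<in> {1, -1}" "c \<in> {1, -1}" "a * b * c = 1" .
          then have "(a, b, c) \<in> {(1, 1, 1), (1, -1, -1), (-1, 1, -1), (-1, -1, 1)}" by auto
          then show ?thesis using * by blast
        qed
        have "\<exists>G\<in>?\<Gamma>'. G *v x \<noteq> x" if "x \<in> {u, v, w}" for x
          using False that by (metis (no_types, lifting))
        from this[of u] this[of v] this[of w] obtain G1 G2 G3 where G: "G1 \<in> ?\<Gamma>'" "G1 *v u \<noteq> u"
          "G2 \<in> ?\<Gamma>'" "G2 *v v \<noteq> v" "G3 \<in> ?\<Gamma>'" "G3 *v w \<noteq> w"
          by (meson insertI1 insertI2)
        have F: "G *v x = x" if "G \<in> ?\<Gamma>'" "x \<in> ?F" for G x
          using that unfolding fixed_space_def by blast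
        have span_F: "span ?F = ?F" using subspace_fixed_space span_eq_iff by blast
        have u_new: "u \<notin> span ?F" unfolding span_F by (rule not_fixed)
        \<comment> \<open>\<open>G3\<close> negates \<open>w\<close>, hence exactly one of
          \<open>u\<close> and \<open>v\<close>; it is applied to the fixed vector
          \<open>v - k *\<^sub>R u\<close>.\<close>
        have v_new: "v \<notin> span (insert u ?F)"
        proof
          assume "v \<in> span (insert u ?F)"
          then obtain k where k: "v - k *\<^sub>R u \<in> ?F" unfolding span_breakdown_eq span_F by blast
          obtain a b c where abc: "G3 *v u = a *\<^sub>R u" "G3 *v v = b *\<^sub>R v" "G3 *v w = c *\<^sub>R w"
            "(a, b, c) \<in> {(1, 1, 1), (1, -1, -1), (-1, 1, -1), (-1, -1, 1::real)}"
            using signs[OF G(5)] by blast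
          have eq: "b *\<^sub>R v - k *\<^sub>R a *\<^sub>R u = v - k *\<^sub>R u"
            using F[OF G(5) k] abc by (simp add: matrix_vector_mult_diff_distrib matrix_vector_mult_scaleR)
          have "c \<noteq> 1" using abc(3) G(6) by auto
          then consider "a = 1" "b = -1" | "a = -1" "b = 1" using abc(4) by auto
          then show False
          proof cases
            case 1
            have "v = 0" using eq unfolding 1 by (simp add: vec_eq_iff)
            then show False using uvw(3) by simp
          next
            case 2
            have "k *\<^sub>R u = 0" using eq unfolding 2 by (simp add: vec_eq_iff)
            then show False using k not_fixed(2) by (metis diff_zero)
          qed
        qed
        \<comment> \<open>\<open>G1\<close> negates \<open>u\<close> and exactly one of
          \<open>v\<close> and \<open>w\<close>. If it negates \<open>w\<close>, then
          \<open>w\<close> is a multiple of \<open>u\<close>, although \<open>G2\<close> negates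
          only one of these two; otherwise \<open>w\<close> lies in the fixed space.\<close>
        have w_new: "w \<notin> span (insert v (insert u ?F))"
        proof
          assume "w \<in> span (insert v (insert u ?F))"
          then obtain l k where k: "w - l *\<^sub>R v - k *\<^sub>R u \<in> ?F" unfolding span_breakdown_eq span_F by blast
          obtain a b c where abc: "G1 *v u = a *\<^sub>R u" "G1 *v v = b *\<^sub>R v" "G1 *v w = c *\<^sub>R w"
            "(a, b, c) \<in> {(1, 1, 1), (1, -1, -1), (-1, 1, -1), (-1, -1, 1::real)}"
            using signs[OF G(1)] by blast
          have eq: "c *\<^sub>R w - l *\<^sub>R b *\<^sub>R v - k *\<^sub>R a *\<^sub>R u = w - l *\<^sub>R v - k *\<^sub>R u"
            using F[OF G(1) k] abc by (simp add: matrix_vector_mult_diff_distrib matrix_vector_mult_scaleR)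
          have "a \<noteq> 1" using abc(1) G(2) by auto
          then consider "a = -1" "b = 1" "c = -1" | "a = -1" "b = -1" "c = 1" using abc(4) by auto
          then show False
          proof cases
            case 1
            have "w $ i = k * u $ i" for i
              using arg_cong[OF eq, of "\<lambda>x. x $ i"] by (simp add: 1)
            then have wu: "w = k *\<^sub>R u" by (simp add: vec_eq_iff)
            obtain a b c where abc: "G2 *v u = a *\<^sub>R u" "G2 *v v = b *\<^sub>R v" "G2 *v w = c *\<^sub>R w"
              "(a, b, c) \<in> {(1, 1, 1), (1, -1, -1), (-1, 1, -1), (-1, -1, 1::real)}"
              using signs[OF G(3)] by blast
            have "c *\<^sub>R w = a *\<^sub>R w" using abc(1,3) unfolding wu by (auto simp: matrix_vector_mult_scaleR)
            then have "c = a" using uvw(4) by simp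
            moreover have "b \<noteq> 1" using abc(2) G(4) by auto
            ultimately show False using abc(4) by auto
          next
            case 2
            have "- (l * v $ i) = k * u $ i" for i
              using arg_cong[OF eq, of "\<lambda>x. x $ i"] by (simp add: 2)
            then have "w = w - l *\<^sub>R v - k *\<^sub>R u" by (simp add: vec_eq_iff)
            then show False using k not_fixed(3) by metis
          qed
        qed
        have dim: "dim ?F + 3 \<le> dim (fixed_space ?\<Gamma>3)"
        proof -
          have "w \<in> fixed_space ?\<Gamma>3"
          proof -
            have "G *v w = w" if G3: "G \<in> ?\<Gamma>3" for G
            proof -
              have "G \<in> ?\<Gamma>'" using G3 by simp
              from signs[OF this] obtain a b c where abc: "G *v u = a *\<^sub>R u" "G *v v = b *\<^sub>R v" "G *v w = c *\<^sub>R w"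
                "(a, b, c) \<in> {(1, 1, 1), (1, -1, -1), (-1, 1, -1), (-1, -1, 1::real)}"
                by blast
              have "a *\<^sub>R u = 1 *\<^sub>R u" "b *\<^sub>R v = 1 *\<^sub>R v" using G3 abc(1,2) by simp_all
              then have "a = 1" "b = 1" using uvw(2,3) unfolding scaleR_cancel_right by simp_all
              then show ?thesis using abc(3,4) by auto
            qed
            then show ?thesis unfolding fixed_space_def by blast
          qed
          then have "insert w (insert v (insert u ?F)) \<subseteq> fixed_space ?\<Gamma>3"
            unfolding fixed_space_def by auto
          then have "dim (insert w (insert v (insert u ?F))) \<le> dim (fixed_space ?\<Gamma>3)" by (rule dim_subset)
          then show ?thesis using u_new v_new w_new by (simp add: dim_insert)
        qed
        have group3: "matrix_group ?\<Gamma>3"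
        proof -
          have fixing: "matrix_group {G \<in> \<Delta>. G *v x = x}" if "matrix_group \<Delta>" for \<Delta> and x :: "real ^ 'm"
            by (rule matrix_group_subset[OF that]) (simp_all add: matrix_vector_mul_assoc[symmetric], metis matrix_inv_mult_vec(1))
          show ?thesis by (intro fixing group')
        qed
        have card3: "finite ?\<Gamma>' \<and> card ?\<Gamma>' \<le> 4 * card ?\<Gamma>3" if fin: "finite ?\<Gamma>3"
        proof -
          let ?Y = "{u, - u} \<times> {v, - v}"
          have "finite ?\<Gamma>' \<and> card ?\<Gamma>' \<le> card ?Y * card ?\<Gamma>3"
          proof (rule matrix_group_card_le[OF group' _ _ fin, where f = "\<lambda>G. (G *v u, G *v v)"])
            show "(\<lambda>G. (G *v u, G *v v)) ` ?\<Gamma>' \<subseteq> ?Y" using signs by fastforce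
            fix A B assume AB: "A \<in> ?\<Gamma>'" "B \<in> ?\<Gamma>'" "(A *v u, A *v v) = (B *v u, B *v v)"
            have "invertible A" "matrix_inv A ** B \<in> ?\<Gamma>'"
              using group' AB(1,2) unfolding matrix_group_def by blast+
            then show "matrix_inv A ** B \<in> ?\<Gamma>3"
              using AB(3) matrix_inv_mult_vec(1)[of A u] matrix_inv_mult_vec(1)[of A v]
              by (simp add: matrix_vector_mul_assoc[symmetric])
          qed simp
          moreover have "card ?Y \<le> 2 * 2"
            unfolding card_cartesian_product by (intro mult_mono) (simp_all add: card_insert_if)
          then have "card ?Y * card ?\<Gamma>3 \<le> 4 * card ?\<Gamma>3" by (intro mult_right_mono) simp_all
          ultimately show ?thesis by linarith
        qed
        show ?thesis
        proof (rule step[of ?\<Gamma>3 "(?r - ?a) * 4" "insert T M"])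
          assume fin: "finite ?\<Gamma>3"
          then have "finite \<Gamma>" "card \<Gamma> \<le> (?r - ?a) * card ?\<Gamma>'" "card ?\<Gamma>' \<le> 4 * card ?\<Gamma>3"
            using card' card3 by blast+
          then show "finite \<Gamma> \<and> card \<Gamma> \<le> (?r - ?a) * 4 * card ?\<Gamma>3"
            by (metis (no_types, lifting) le_trans mult.assoc mult_le_mono2)
        next
          have "4 * 2 ^ (dim ?F - 1 - ?a) = (2 :: nat) ^ (dim ?F - 1 - ?a + 2)"
            by (simp add: power_add)
          also have "\<dots> \<le> 2 ^ (dim (fixed_space ?\<Gamma>3) - 1 - (?a + 1))"
            using dim slack by (intro power_increasing) auto
          finally have le: "4 * 2 ^ (dim ?F - 1 - ?a) \<le> (2 :: nat) ^ (dim (fixed_space ?\<Gamma>3) - 1 - (?a + 1))" .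
          show "(?r - ?a) * 4 * 2 ^ (dim ?F - 1 - ?a) * fact (?r - card (insert T M))
            \<le> 2 ^ (dim (fixed_space ?\<Gamma>3) - 1 - card (insert T M)) * (fact (?r - ?a) :: nat)"
            unfolding cardM' fact_rec[symmetric]
            using mult_le_mono2[OF le, of "(?r - ?a) * fact (?r - (?a + 1))"] by (simp only: mult_ac)
        qed (use group3 M T(1) dim slack cardM' in auto)
      qed
    qed
  qed
qed

text \<open>Matrices with the same image of \<open>D\<close> differ by an element of
  \<open>term_permuting\<close>. The factorials are multiplied out; the difference in the argument
  is genuine because the rank is at least the dimension.\<close>

lemma finite_stabilizer:
  "finite stabilizer \<and>
    card stabilizer * fact (tensor_rank C - CARD('m)) \<le> card (minimal_decompositions C) * (fact (tensor_rank C) :: nat)"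
proof -
  \<comment> \<open>The end point supplies the \<open>+ 1\<close> that the induction demands at its
    start, when no terms are known to be fixed.\<close>
  have "\<l> \<in> fixed_space term_permuting"
    using stabilizer_fixes_endpoint unfolding fixed_space_def term_permuting_def stabilizer_def by blast
  then have "dim {\<l>} \<le> dim (fixed_space term_permuting)" by (intro dim_subset) simp
  then have dim: "card ({} :: (real ^ 'm ^ 'm ^ 'm) set) + 1 \<le> dim (fixed_space term_permuting)"
    using not_loop by simp
  let ?d = "dim (fixed_space term_permuting) - 1"
  have *: "finite term_permuting \<and> card term_permuting * 2 ^ ?d * fact (tensor_rank C - CARD('m))
      \<le> (fact (tensor_rank C) :: nat)"
    using card_fixing_subgroup_le[OF matrix_group_term_permuting order_refl empty_subsetI _ dim CARD_le_tensor_rank]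
    by simp
  moreover have "card term_permuting * 1 * fact (tensor_rank C - CARD('m))
      \<le> card term_permuting * 2 ^ ?d * (fact (tensor_rank C - CARD('m)) :: nat)"
    by (intro mult_right_mono mult_left_mono) simp_all
  ultimately have fin: "finite term_permuting"
    and le: "card term_permuting * fact (tensor_rank C - CARD('m)) \<le> (fact (tensor_rank C) :: nat)"
    unfolding mult_1_right by linarith+
  have "finite stabilizer \<and> card stabilizer \<le> card (minimal_decompositions C) * card term_permuting"
  proof (rule matrix_group_card_le[OF matrix_group_stabilizer finite_minimal_decompositions _ fin,
        where f = "\<lambda>A. image_mset (\<lambda>T. tensor_act T A A A) D"])
    show "(\<lambda>A. image_mset (\<lambda>T. tensor_act T A A A) D) ` stabilizer \<subseteq> minimal_decompositions C"
      using image_mset_minimal_decompositions[OF D stabilizer_invertible] unfolding stabilizer_def by blast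
    fix A B :: "real ^ 'm ^ 'm"
    let ?A' = "matrix_inv A"
    assume AB: "A \<in> stabilizer" "B \<in> stabilizer"
      "image_mset (\<lambda>T. tensor_act T A A A) D = image_mset (\<lambda>T. tensor_act T B B B) D"
    have "image_mset (\<lambda>T. tensor_act T (?A' ** B) (?A' ** B) (?A' ** B)) D
        = image_mset (\<lambda>T. tensor_act T ?A' ?A' ?A') (image_mset (\<lambda>T. tensor_act T B B B) D)"
      by (simp add: multiset.map_comp o_def tensor_act_tensor_act)
    also have "\<dots> = D"
      unfolding AB(3)[symmetric]
      by (simp add: multiset.map_comp o_def tensor_act_matrix_inv stabilizer_invertible[OF AB(1)])
    finally show "?A' ** B \<in> term_permuting"
      using matrix_group_stabilizer AB(1,2) unfolding term_permuting_def matrix_group_def by blast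
  qed
  moreover have "card (minimal_decompositions C) * card term_permuting * fact (tensor_rank C - CARD('m))
    \<le> card (minimal_decompositions C) * (fact (tensor_rank C) :: nat)"
    unfolding mult.assoc by (rule mult_le_mono2[OF le])
  ultimately show ?thesis by (meson le_trans mult_le_mono1)
qed

text \<open>Acting with \<open>L\<close> on the equation shows that \<open>L ** Y\<close> stabilizes
  \<open>C\<close>. The projection \<open>R\<close> kills \<open>X\<close>, so the rows of
  \<open>R ** Y\<close> kill every slot of \<open>C\<close> and vanish by conciseness.\<close>

lemma same_tensor_factors:
  fixes X Y :: "real ^ 'm ^ 'd" and L :: "real ^ 'd ^ 'm"
  assumes L: "L ** X = mat 1" and eq: "tensor_act C Y Y Y = tensor_act C X X X"
  shows "L ** Y \<in> stabilizer \<and> Y = X ** (L ** Y)"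
proof -
  have "tensor_act C (L ** Y) (L ** Y) (L ** Y) = tensor_act C (L ** X) (L ** X) (L ** X)"
    using eq by (simp flip: tensor_act_tensor_act)
  then have stab: "L ** Y \<in> stabilizer" by (simp add: L stabilizer_def)
  \<comment> \<open>A left inverse of \<open>Y\<close>: it lets arbitrary \<open>g\<close> and
    \<open>h\<close> appear as rows of some \<open>B ** Y\<close> in the other two slots.\<close>
  define Q where "Q = matrix_inv (L ** Y) ** L"
  have QY: "Q ** Y = mat 1"
    using matrix_inv_mult(1)[OF stabilizer_invertible[OF stab]] by (simp add: Q_def matrix_mul_assoc)
  define R where "R = mat 1 - X ** L"
  have R: "R ** Z = Z - X ** (L ** Z)" for Z :: "real ^ 'm ^ 'd"
    by (simp add: R_def matrix_eq matrix_vector_mul_assoc[symmetric] matrix_vector_mult_diff_rdistrib)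
  have RX: "(R ** X) $ a = 0" for a by (simp add: R L)
  have zero: "trilin C 0 g h = 0" "trilin C g 0 h = 0" "trilin C g h 0 = 0" for g h
    by (simp_all add: trilin_def)
  have "(R ** Y) $ a = 0" for a
  proof (rule symmetrically_concise_functional[OF concise])
    fix g h :: "real ^ 'm"
    let ?g = "(\<chi> i. g) :: real ^ 'm ^ 'd" and ?h = "(\<chi> i. h) :: real ^ 'm ^ 'd"
    have B: "(B ** Q) ** Y = B" for B :: "real ^ 'm ^ 'd"
      by (simp add: QY flip: matrix_mul_assoc)
    have act: "tensor_act C (K ** Y) (K' ** Y) (K'' ** Y) = tensor_act C (K ** X) (K' ** X) (K'' ** X)"
      for K K' K'' :: "real ^ 'd ^ 'd"
      using eq by (simp flip: tensor_act_tensor_act)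
    have "trilin C ((R ** Y) $ a) (?g $ a) (?h $ a) = 0"
      using arg_cong[OF act[of R "?g ** Q" "?h ** Q"], of "\<lambda>T. T $ a $ a $ a"]
      unfolding tensor_act_nth B RX zero .
    then show "trilin C ((R ** Y) $ a) g h = 0" by simp
    have "trilin C (?g $ a) ((R ** Y) $ a) (?h $ a) = 0"
      using arg_cong[OF act[of "?g ** Q" R "?h ** Q"], of "\<lambda>T. T $ a $ a $ a"]
      unfolding tensor_act_nth B RX zero .
    then show "trilin C g ((R ** Y) $ a) h = 0" by simp
    have "trilin C (?g $ a) (?h $ a) ((R ** Y) $ a) = 0"
      using arg_cong[OF act[of "?g ** Q" "?h ** Q" R], of "\<lambda>T. T $ a $ a $ a"]
      unfolding tensor_act_nth B RX zero .
    then show "trilin C g h ((R ** Y) $ a) = 0" by simp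
  qed
  then have "R ** Y = 0" by (simp add: vec_eq_iff)
  then show ?thesis using stab R[of Y] by simp
qed

text \<open>\<open>Y\<close> is recovered from \<open>L ** Y\<close>, so the solutions inject into
  the stabilizer. Finiteness is stated separately because \<open>card\<close> of an infinite set is
  0.\<close>

lemma card_same_tensor:
  fixes X :: "real ^ 'm ^ 'd" and L :: "real ^ 'd ^ 'm"
  assumes L: "L ** X = mat 1"
  shows "finite {Y. tensor_act C Y Y Y = tensor_act C X X X} \<and>
    real (card {Y. tensor_act C Y Y Y = tensor_act C X X X})
      \<le> real (card (minimal_decompositions C)) * (fact (tensor_rank C) / fact (tensor_rank C - CARD('m)))"
proof -
  let ?Ys = "{Y. tensor_act C Y Y Y = tensor_act C X X X}"
  have "inj_on (\<lambda>Y. L ** Y) ?Ys"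
  proof (rule inj_onI)
    fix Y Y' assume "Y \<in> ?Ys" "Y' \<in> ?Ys" "L ** Y = L ** Y'"
    then show "Y = Y'"
      using same_tensor_factors[OF L, of Y] same_tensor_factors[OF L, of Y'] by simp
  qed
  moreover have "(\<lambda>Y. L ** Y) ` ?Ys \<subseteq> stabilizer" using same_tensor_factors[OF L] by blast
  ultimately have "finite ?Ys" and le: "card ?Ys \<le> card stabilizer"
    using finite_stabilizer inj_on_finite card_inj_on_le by blast+
  have "card ?Ys * fact (tensor_rank C - CARD('m)) \<le> card (minimal_decompositions C) * (fact (tensor_rank C) :: nat)"
    using finite_stabilizer le by (meson le_trans mult_le_mono1)
  then have "real (card ?Ys * fact (tensor_rank C - CARD('m))) \<le> real (card (minimal_decompositions C) * fact (tensor_rank C))"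
    by (simp only: of_nat_le_iff)
  then have "real (card ?Ys) * fact (tensor_rank C - CARD('m)) \<le> real (card (minimal_decompositions C)) * fact (tensor_rank C)"
    by simp
  then show ?thesis using \<open>finite ?Ys\<close> by (simp add: pos_le_divide_eq)
qed

end

section \<open>Generic matrices\<close>

lemma real_polynomial_function_component: "real_polynomial_function (\<lambda>X :: real ^ 'm ^ 'd. X $ a $ i)"
  by (intro real_polynomial_function.intros(1) bounded_linear_compose[OF bounded_linear_vec_nth bounded_linear_vec_nth])

text \<open>One maximal minor suffices: where it does not vanish, the selection of its rows followed
  by the inverse of the square block is a left inverse.\<close>

lemma generic_left_inverse:
  assumes "CARD('m) \<le> CARD('d)"
  obtains Z where "zariski_closed Z" "Z \<noteq> UNIV" "\<And>X :: real ^ 'm ^ 'd. X \<notin> Z \<Longrightarrow> \<exists>L. L ** X = mat 1"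
proof -
  obtain g :: "'m \<Rightarrow> 'd" where g: "inj g"
    using card_le_inj[of "UNIV :: 'm set" "UNIV :: 'd set"] assms by auto
  define minor where "minor X = (\<chi> i j. X $ g i $ j)" for X :: "real ^ 'm ^ 'd"
  let ?Z = "{X. det (minor X) = 0}"
  show thesis
  proof
    have "real_polynomial_function (\<lambda>X. det (minor X))"
      unfolding det_def minor_def
      by (simp, intro real_polynomial_function_sum real_polynomial_function.intros(4) real_polynomial_function_prod
          real_polynomial_function_component real_polynomial_function.intros(2)) auto
    then show "zariski_closed ?Z"
      unfolding zariski_closed_def by (intro exI[of _ "{\<lambda>X. det (minor X)}"]) auto
    have "minor (\<chi> a j. if a = g j then 1 else 0) = mat 1"
      using g by (simp add: minor_def mat_def vec_eq_iff inj_eq)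
    then have "(\<chi> a j. if a = g j then 1 else 0) \<notin> ?Z" by simp
    then show "?Z \<noteq> UNIV" by blast
    fix X :: "real ^ 'm ^ 'd"
    assume "X \<notin> ?Z"
    then have "invertible (minor X)" by (simp add: invertible_det_nz)
    moreover have "(\<chi> i a. if a = g i then 1 else 0) ** X = minor X"
      by (simp add: matrix_matrix_mult_def minor_def vec_eq_iff if_distrib[of "\<lambda>x. x * _"] cong: if_cong)
    ultimately have "(matrix_inv (minor X) ** (\<chi> i a. if a = g i then 1 else 0)) ** X = mat 1"
      using matrix_inv_mult(1) by (simp flip: matrix_mul_assoc)
    then show "\<exists>L. L ** X = mat 1" by blast
  qed
qed

theorem theorem4p6:
  fixes \<psi> :: "real \<Rightarrow> real ^ 'm" and C :: "real ^ 'm ^ 'm ^ 'm" and r \<delta> :: nat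
  assumes "dictionary \<psi>" and "has_core_tensor \<psi>"
    and "\<psi> 0 \<noteq> \<psi> 1"
    and "C = core_tensor \<psi>"
    and "symmetrically_concise C"
    and "r = tensor_rank C"
    and "finite (minimal_decompositions C)"
    and "\<delta> = card (minimal_decompositions C)"
    and "CARD('m) \<le> CARD('d)"
  shows "for_generic (\<lambda>X :: real ^ 'm ^ 'd.
           finite {Y :: real ^ 'm ^ 'd. tensor_act C Y Y Y = tensor_act C X X X} \<and>
           real (card {Y :: real ^ 'm ^ 'd. tensor_act C Y Y Y = tensor_act C X X X})
             \<le> real \<delta> * (fact r / fact (r - CARD('m))))"
proof -
  obtain D where D: "D \<in> minimal_decompositions C" using minimal_decompositions_nonempty by blast
  \<comment> \<open>The increment of the path and its second level take the places of
    \<open>\<l>\<close> and \<open>S\<close>.\<close>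
  interpret minimal_signature_decomposition C "\<psi> 1 - \<psi> 0" "\<chi> j k. iterated2 \<psi> j k 1" D
  proof
    show "C $ i $ j $ k + C $ j $ i $ k + C $ j $ k $ i = (\<psi> 1 - \<psi> 0) $ i * (\<chi> j k. iterated2 \<psi> j k 1) $ j $ k" for i j k
      using core_tensor_shuffle[OF assms(1,2)] by (simp add: assms(4))
    show "(\<chi> j k. iterated2 \<psi> j k 1) $ i $ j + (\<chi> j k. iterated2 \<psi> j k 1) $ j $ i
        = (\<psi> 1 - \<psi> 0) $ i * (\<psi> 1 - \<psi> 0) $ j" for i j
      using iterated2_add_swap[OF assms(1,2), of 1 i j] iterated1_dictionary[OF assms(1), of 1] by simp
  qed (use assms D in simp_all)
  obtain Z where "zariski_closed Z" "Z \<noteq> UNIV" "\<And>X :: real ^ 'm ^ 'd. X \<notin> Z \<Longrightarrow> \<exists>L. L ** X = mat 1"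
    using generic_left_inverse[OF assms(9)] by blast
  then show ?thesis
    unfolding for_generic_def assms(6,8) using card_same_tensor by blast
qed

end
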